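(* Let $X_1,X_2,\dots$ be i.i.d. with $\mathbf{E}X_1=-a<0$ and $\mathrm{Var}(X_1)<\infty$. Assume $\overline F(x)\sim e^{-g(x)}x^{-2}$ as $x\to\infty$, where $g:(0,\infty)\to\mathbb{R}$ is continuously differentiable, nondecreasing for all sufficiently large $x$, and such that $x\mapsto g(x)/x$ is nonincreasing on $(0,\infty)$ with $g(x)/x\to0$. Then: (i) there exists a constant $C>0$ such that for all sufficiently large $x$, \[ \mathbf{P}(A_\tau>x)\le Cx^{1/4}\exp\left\{-g(\sqrt{2ax})\sqrt{1-\frac{2Cg(\sqrt{2ax})}{a\sqrt{2ax}}}\right\}; \] (ii) for every $\varepsilon>0$ there exists $C>0$ such that \[ \liminf_{x\to\infty}\frac{\mathbf{P}(A_\tau>x)}{\overline F(\sqrt{2ax}+Cx^{1/4+\varepsilon})}\ge\mathbf{E}\tau; \] (iii) if moreover there is $\gamma_0\in(0,1)$ such that $x\mapsto g(x)/x^{\gamma_0}$ is nonincreasing on $(0,\infty)$ with $g(x)/x^{\gamma_0}\to0$, then \[ \lim_{x\to\infty}\frac{\ln\mathbf{P}(A_\tau>x)}{\ln\overline F(\sqrt{2ax})}=1. \]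
   Context: $S_0=0$, $S_n=X_1+\dots+X_n$, $\overline F(x)=\mathbf{P}(X_1>x)$, $\tau=\min\{n\ge1:S_n\le0\}$, $A_\tau=\sum_{k=0}^{\tau-1}S_k$. *)

theory Defs
  imports "HOL-Probability.Probability" "HOL-Library.Landau_Symbols"
begin

definition rw_S :: "(nat \<Rightarrow> 'a \<Rightarrow> real) \<Rightarrow> nat \<Rightarrow> 'a \<Rightarrow> real" where
  "rw_S X n \<omega> = (\<Sum>k\<in>{1..n}. X k \<omega>)"

definition Fbar :: "'a measure \<Rightarrow> (nat \<Rightarrow> 'a \<Rightarrow> real) \<Rightarrow> real \<Rightarrow> real" where
  "Fbar M X x = measure M {\<omega> \<in> space M. X 1 \<omega> > x}"

definition rw_tau :: "(nat \<Rightarrow> 'a \<Rightarrow> real) \<Rightarrow> 'a \<Rightarrow> nat" where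
  "rw_tau X \<omega> = (LEAST n. 1 \<le> n \<and> rw_S X n \<omega> \<le> 0)"

text \<open>A_tau = S_0 + ... + S_(tau-1); set to 0 on the (null) event tau = infinity.\<close>
definition rw_A :: "(nat \<Rightarrow> 'a \<Rightarrow> real) \<Rightarrow> 'a \<Rightarrow> real" where
  "rw_A X \<omega> = (if \<exists>n\<ge>1. rw_S X n \<omega> \<le> 0
                then (\<Sum>k<rw_tau X \<omega>. rw_S X k \<omega>) else 0)"

end

theory Submission
  imports Defs "HOL-Real_Asymp.Real_Asymp"
begin

text \<open>
  Write \<open>y = sqrt (2 a x)\<close>, so that a walk starting at height \<open>y\<close> and moving with slope \<open>- a\<close>
  covers area \<open>x\<close> before hitting zero.

  For the upper bounds, a step exceeding a level \<open>c\<close> before time \<open>\<tau>\<close> costs at most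
  \<open>E \<tau> * Fbar c\<close>.  Otherwise the steps are truncated, and since the area of an excursion of
  length \<open>n\<close> is the linear form \<open>\<Sum>j\<le>n. (n - j) X j\<close>, Chernoff's bound with
  parameter \<open>l / n\<close> gives the exponent \<open>- l (x / n + a n / 2) \<le> - l y\<close>.  The choice
  \<open>l = (g y + (ln y) / 2) / y\<close> is admissible because \<open>g t / t\<close> is nonincreasing and because of
  the factor \<open>t powr (-2)\<close> in the tail; the extra \<open>(ln y) / 2\<close> pays for half of the sum over \<open>n\<close>
  and leaves \<open>sqrt y\<close>, of order \<open>x powr (1/4)\<close>.  For the logarithmic asymptotics the
  steps are split at \<open>\<eta> y\<close>: the small ones are handled with \<open>l\<close> a large multiple of
  \<open>(g y + ln y) / y\<close>, and if the larger ones add up to more than \<open>(1 - d) y\<close> without any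
  single one doing so, then at least two of \<open>O(y)\<close> steps exceed \<open>\<eta> y\<close>, which contributes
  the factor \<open>(y * y powr (-2))\<^sup>2\<close> and thus no more than the single large step.

  For the lower bound, one step beyond \<open>y + x powr (1/4 + \<epsilon>)\<close> at time \<open>k \<le> \<tau>\<close> suffices,
  because by a maximal inequality the centred walk stays above \<open>- x powr (1/4 + \<epsilon>) / 2\<close> during the
  \<open>O(sqrt x)\<close> steps needed to collect area \<open>x\<close>; summing over \<open>k\<close> gives \<open>E \<tau>\<close>.
\<close>

section \<open>Setting: i.i.d. square-integrable steps with negative mean\<close>

locale negative_drift_walk = prob_space M for M :: "'a measure" +
  fixes X :: "nat \<Rightarrow> 'a \<Rightarrow> real" and a :: real
  assumes X_measurable [measurable]: "\<And>k. X k \<in> borel_measurable M"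
    and X_indep: "indep_vars (\<lambda>_. borel) X {1..}"
    and X_ident: "\<And>k. k \<ge> 1 \<Longrightarrow> distr M borel (X k) = distr M borel (X 1)"
    and a_pos: "a > 0"
    and X_square_integrable: "integrable M (\<lambda>\<omega>. (X 1 \<omega>)\<^sup>2)"
    and X_mean: "expectation (X 1) = - a"
begin

lemma expectation_step:
  fixes f :: "real \<Rightarrow> real"
  assumes "k \<ge> 1" and [measurable]: "f \<in> borel_measurable borel"
  shows "expectation (\<lambda>\<omega>. f (X k \<omega>)) = expectation (\<lambda>\<omega>. f (X 1 \<omega>))"
proof -
  have "expectation (\<lambda>\<omega>. f (X j \<omega>)) = integral\<^sup>L (distr M borel (X j)) f" for j
    by (rule integral_distr[symmetric]) measurable
  then show ?thesis
    by (simp only: X_ident[OF assms(1)])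
qed

lemma integrable_step:
  fixes f :: "real \<Rightarrow> real"
  assumes "k \<ge> 1" and [measurable]: "f \<in> borel_measurable borel"
  shows "integrable M (\<lambda>\<omega>. f (X k \<omega>)) \<longleftrightarrow> integrable M (\<lambda>\<omega>. f (X 1 \<omega>))"
proof -
  have "integrable M (\<lambda>\<omega>. f (X j \<omega>)) = integrable (distr M borel (X j)) f" for j
    by (rule integrable_distr_eq[symmetric]) measurable
  then show ?thesis
    by (simp only: X_ident[OF assms(1)])
qed

lemma integrable_X1: "integrable M (X 1)"
  by (rule square_integrable_imp_integrable[OF X_measurable X_square_integrable])

lemma integrable_X: "k \<ge> 1 \<Longrightarrow> integrable M (X k)"
  by (rule integrable_step[of k "\<lambda>z. z", THEN iffD2]) (auto intro: integrable_X1[simplified])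

lemma expectation_X: "k \<ge> 1 \<Longrightarrow> expectation (X k) = - a"
  using expectation_step[of k "\<lambda>z. z"] X_mean by simp

lemma integrable_X_square: "k \<ge> 1 \<Longrightarrow> integrable M (\<lambda>\<omega>. (X k \<omega>)\<^sup>2)"
  using integrable_step[of k "\<lambda>z. z\<^sup>2"] X_square_integrable by simp

lemma expectation_of_bool:
  assumes [measurable]: "Measurable.pred M R"
  shows "expectation (\<lambda>\<omega>. of_bool (R \<omega>) :: real) = prob {\<omega> \<in> space M. R \<omega>}"
proof -
  have "expectation (\<lambda>\<omega>. of_bool (R \<omega>) :: real) = expectation (indicator {\<omega> \<in> space M. R \<omega>})"
    by (intro Bochner_Integration.integral_cong) (auto simp: indicator_def)
  then show ?thesis by simp
qed

lemma prob_step_gt: "k \<ge> 1 \<Longrightarrow> prob {\<omega> \<in> space M. X k \<omega> > b} = Fbar M X b"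
  using expectation_step[of k "\<lambda>z. of_bool (z > b)"] expectation_of_bool[of "\<lambda>\<omega>. X k \<omega> > b"]
    expectation_of_bool[of "\<lambda>\<omega>. X 1 \<omega> > b"]
  by (simp add: Fbar_def)

lemma Fbar_nonneg: "0 \<le> Fbar M X b"
  by (simp add: Fbar_def)

definition second_moment :: real where
  "second_moment = expectation (\<lambda>\<omega>. (X 1 \<omega>)\<^sup>2)"

lemma second_moment_nonneg: "0 \<le> second_moment"
  by (simp add: second_moment_def)

subsection \<open>Independence of blocks of steps\<close>

text \<open>The sigma-algebra generated by the steps with index in \<open>I\<close>. It is the
  pullback of the product sigma-algebra along the restricted vector, the form in which
  \<open>indep_var_restrict\<close> delivers independence.\<close>

definition coord_algebra :: "nat set \<Rightarrow> 'a measure" where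
  "coord_algebra I = vimage_algebra (space M) (\<lambda>\<omega>. \<lambda>i\<in>I. X i \<omega>) (PiM I (\<lambda>_. borel))"

lemma space_coord_algebra [simp]: "space (coord_algebra I) = space M"
  by (simp add: coord_algebra_def)

lemma X_coord_measurable: "i \<in> I \<Longrightarrow> X i \<in> borel_measurable (coord_algebra I)"
proof -
  assume i: "i \<in> I"
  have "(\<lambda>\<omega>. \<lambda>i\<in>I. X i \<omega>) \<in> measurable (coord_algebra I) (PiM I (\<lambda>_. borel))"
    unfolding coord_algebra_def by (intro measurable_vimage_algebra1) (auto simp: space_PiM)
  from measurable_compose[OF this measurable_component_singleton[OF i]] i show ?thesis
    by simp
qed

lemma sets_coord_algebra_subset: "sets (coord_algebra I) \<subseteq> events"
proof -
  have "(\<lambda>\<omega>. \<lambda>i\<in>I. X i \<omega>) \<in> measurable M (PiM I (\<lambda>_. borel))"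
    by measurable
  then show ?thesis
    unfolding coord_algebra_def sets_vimage_algebra
    by (intro sets.sigma_sets_subset) (auto simp: measurable_sets)
qed

lemma coord_measurable_imp: "F \<in> measurable (coord_algebra I) N \<Longrightarrow> F \<in> measurable M N"
  using sets_coord_algebra_subset[of I] by (auto simp: measurable_def)

text \<open>Disjoint blocks of steps generate independent sigma-algebras, and measurability of
  \<open>F\<close> and \<open>G\<close> places their generated sigma-algebras inside these.\<close>

lemma indep_var_coord:
  assumes "I \<inter> J = {}" "I \<subseteq> {1..}" "J \<subseteq> {1..}"
    and F: "F \<in> borel_measurable (coord_algebra I)"
    and G: "G \<in> borel_measurable (coord_algebra J)"
  shows "indep_var borel F borel G"
proof -
  have "indep_var (PiM I (\<lambda>_. borel)) (\<lambda>\<omega>. restrict (\<lambda>i. X i \<omega>) I)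
      (PiM J (\<lambda>_. borel)) (\<lambda>\<omega>. restrict (\<lambda>i. X i \<omega>) J)"
    by (rule indep_var_restrict[OF X_indep assms(1-3)])
  then have ind: "indep_set (sets (coord_algebra I)) (sets (coord_algebra J))"
    unfolding indep_var_eq coord_algebra_def sets_vimage_algebra by (elim conjE)
  have sub: "sigma_sets (space M) {F -` A \<inter> space M |A. A \<in> sets borel} \<subseteq> sets (coord_algebra I)"
    if "F \<in> borel_measurable (coord_algebra I)" for F :: "'a \<Rightarrow> 'b::topological_space" and I
  proof -
    have "{F -` A \<inter> space M |A. A \<in> sets borel} \<subseteq> sets (coord_algebra I)"
      using measurable_sets[OF that] by (auto simp del: vimage_Int)
    from sets.sigma_sets_subset[OF this] show ?thesis by simp
  qed
  show ?thesis
    unfolding indep_var_eq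
  proof (intro conjI)
    show "indep_set (sigma_sets (space M) {F -` A \<inter> space M |A. A \<in> sets borel})
        (sigma_sets (space M) {G -` A \<inter> space M |A. A \<in> sets borel})"
      using ind sub[OF F] sub[OF G] unfolding indep_sets2_eq
      by (meson subset_trans subsetD)
  qed (rule coord_measurable_imp[OF F], rule coord_measurable_imp[OF G])
qed

lemma expectation_mult_coord:
  fixes F G :: "'a \<Rightarrow> real"
  assumes "I \<inter> J = {}" "I \<subseteq> {1..}" "J \<subseteq> {1..}"
    and "F \<in> borel_measurable (coord_algebra I)" "G \<in> borel_measurable (coord_algebra J)"
    and "integrable M F" "integrable M G"
  shows "expectation (\<lambda>\<omega>. F \<omega> * G \<omega>) = expectation F * expectation G"
    and "integrable M (\<lambda>\<omega>. F \<omega> * G \<omega>)"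
  by (rule indep_var_lebesgue_integral[OF indep_var_coord[OF assms(1-5)] assms(6,7)],
      rule indep_var_integrable[OF indep_var_coord[OF assms(1-5)] assms(6,7)])

lemma prob_conj_coord:
  assumes "I \<inter> J = {}" "I \<subseteq> {1..}" "J \<subseteq> {1..}"
    and P: "Measurable.pred (coord_algebra I) P" and Q: "Measurable.pred (coord_algebra J) Q"
  shows "prob {\<omega> \<in> space M. P \<omega> \<and> Q \<omega>} = prob {\<omega> \<in> space M. P \<omega>} * prob {\<omega> \<in> space M. Q \<omega>}"
proof -
  have PM [measurable]: "Measurable.pred M P" "Measurable.pred M Q"
    using P Q by (auto intro: coord_measurable_imp)
  have "expectation (\<lambda>\<omega>. of_bool (P \<omega>) * of_bool (Q \<omega>) :: real) =
      expectation (\<lambda>\<omega>. of_bool (P \<omega>)) * expectation (\<lambda>\<omega>. of_bool (Q \<omega>))"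
    using P Q by (intro expectation_mult_coord(1)[OF assms(1-3)])
      (auto intro!: integrable_const_bound[where B=1])
  then show ?thesis
    using PM by (simp add: expectation_of_bool flip: of_bool_conj)
qed

text \<open>Independence factorises the expectation; identical distribution then moves every factor
  to \<open>X 1\<close>, while \<open>f j\<close> may still vary with \<open>j\<close>, as weighted
  exponentials do.\<close>

lemma expectation_prod_steps:
  assumes "\<And>j. j \<in> {1..n} \<Longrightarrow> f j \<in> borel_measurable borel"
    and "\<And>j. j \<in> {1..n} \<Longrightarrow> integrable M (\<lambda>\<omega>. f j (X 1 \<omega>) :: real)"
  shows "expectation (\<lambda>\<omega>. \<Prod>j\<in>{1..n}. f j (X j \<omega>)) = (\<Prod>j\<in>{1..n}. expectation (\<lambda>\<omega>. f j (X 1 \<omega>)))"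
    and "integrable M (\<lambda>\<omega>. \<Prod>j\<in>{1..n}. f j (X j \<omega>))"
proof -
  have "indep_vars (\<lambda>_. borel) X {1..n}"
    by (rule indep_vars_subset[OF X_indep]) auto
  then have ind: "indep_vars (\<lambda>_. borel) (\<lambda>j \<omega>. f j (X j \<omega>)) {1..n}"
    by (rule indep_vars_compose2) (use assms in auto)
  have int: "integrable M (\<lambda>\<omega>. f j (X j \<omega>))" if "j \<in> {1..n}" for j
    using integrable_step[of j "f j"] assms[OF that] that by auto
  show "integrable M (\<lambda>\<omega>. \<Prod>j\<in>{1..n}. f j (X j \<omega>))"
    by (rule indep_vars_integrable[OF _ ind int]) auto
  have "expectation (\<lambda>\<omega>. \<Prod>j\<in>{1..n}. f j (X j \<omega>)) = (\<Prod>j\<in>{1..n}. expectation (\<lambda>\<omega>. f j (X j \<omega>)))"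
    by (rule indep_vars_lebesgue_integral[OF _ ind int]) auto
  also have "\<dots> = (\<Prod>j\<in>{1..n}. expectation (\<lambda>\<omega>. f j (X 1 \<omega>)))"
    using assms by (intro prod.cong refl expectation_step) auto
  finally show "expectation (\<lambda>\<omega>. \<Prod>j\<in>{1..n}. f j (X j \<omega>)) =
      (\<Prod>j\<in>{1..n}. expectation (\<lambda>\<omega>. f j (X 1 \<omega>)))" .
qed

subsection \<open>The hitting time has finite mean\<close>

text \<open>This is the event \<tau> \<ge> j, written without \<open>rw_tau\<close> because
  \<open>LEAST\<close> says nothing on paths that never reach zero. It involves only steps before
  \<open>j\<close>, hence is independent of \<open>X j\<close>.\<close>

definition alive :: "nat \<Rightarrow> 'a \<Rightarrow> bool" where
  "alive j \<omega> \<longleftrightarrow> (\<forall>i\<in>{1..<j}. rw_S X i \<omega> > 0)"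

definition alive_prob :: "nat \<Rightarrow> real" where
  "alive_prob j = prob {\<omega> \<in> space M. alive j \<omega>}"

lemma rw_S_0 [simp]: "rw_S X 0 \<omega> = 0"
  by (simp add: rw_S_def)

lemma rw_S_Suc: "rw_S X (Suc n) \<omega> = rw_S X n \<omega> + X (Suc n) \<omega>"
  by (simp add: rw_S_def)

lemma rw_S_measurable [measurable]: "rw_S X n \<in> borel_measurable M"
  unfolding rw_S_def by measurable

lemma rw_S_coord_measurable: "{1..n} \<subseteq> I \<Longrightarrow> rw_S X n \<in> borel_measurable (coord_algebra I)"
  unfolding rw_S_def by (intro borel_measurable_sum X_coord_measurable) auto

lemma alive_coord_measurable: "Measurable.pred (coord_algebra {1..<j}) (alive j)"
proof -
  have [measurable]: "rw_S X i \<in> borel_measurable (coord_algebra {1..<j})" if "i \<in> {1..<j}" for i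
    using that by (intro rw_S_coord_measurable) auto
  show ?thesis
    unfolding alive_def by measurable
qed

lemma alive_measurable [measurable]: "Measurable.pred M (alive j)"
  by (rule coord_measurable_imp[OF alive_coord_measurable])

lemma alive_antimono: "alive j \<omega> \<Longrightarrow> i \<le> j \<Longrightarrow> alive i \<omega>"
  by (auto simp: alive_def)

lemma alive_Suc: "alive (Suc n) \<omega> \<longleftrightarrow> alive n \<omega> \<and> (n \<ge> 1 \<longrightarrow> rw_S X n \<omega> > 0)"
  by (auto simp: alive_def less_Suc_eq)

lemma alive_Suc_0 [simp]: "alive (Suc 0) \<omega>"
  by (simp add: alive_def)

lemma alive_prob_nonneg: "0 \<le> alive_prob j"
  by (simp add: alive_prob_def)

text \<open>The sum is the walk stopped at \<tau>. It is nonnegative while the walk is alive, and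
  the step of first passage \<open>z\<close> satisfies z \<ge> - (c / 2 + z^2 / (2 c)) by completing
  the square. This one square is then bounded by the sum of all squares up to \<tau>, whose mean is
  computable.\<close>

lemma stopped_sum_lower:
  assumes c: "c > 0"
  shows "(alive (Suc n) \<omega> \<longrightarrow> (\<Sum>j\<in>{1..n}. of_bool (alive j \<omega>) * X j \<omega>) = rw_S X n \<omega> \<and> 0 \<le> rw_S X n \<omega>)
    \<and> - (c / 2 + (\<Sum>j\<in>{1..n}. of_bool (alive j \<omega>) * (X j \<omega>)\<^sup>2) / (2 * c))
        \<le> (\<Sum>j\<in>{1..n}. of_bool (alive j \<omega>) * X j \<omega>)"
proof (induction n)
  case 0
  then show ?case using c by simp
next
  case (Suc n)
  let ?U = "\<lambda>n. \<Sum>j\<in>{1..n}. of_bool (alive j \<omega>) * X j \<omega>"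
  let ?V = "\<lambda>n. \<Sum>j\<in>{1..n}. of_bool (alive j \<omega>) * (X j \<omega>)\<^sup>2"
  have V0: "0 \<le> ?V n" by (intro sum_nonneg) auto
  show ?case
  proof (cases "alive (Suc n) \<omega>")
    case True
    then have U: "?U (Suc n) = rw_S X n \<omega> + X (Suc n) \<omega>" "0 \<le> rw_S X n \<omega>"
      and V: "?V (Suc n) = ?V n + (X (Suc n) \<omega>)\<^sup>2"
      using Suc.IH by auto
    have "0 \<le> (c + X (Suc n) \<omega>)\<^sup>2 / (2 * c)" using c by simp
    also have "\<dots> = c / 2 + X (Suc n) \<omega> + (X (Suc n) \<omega>)\<^sup>2 / (2 * c)"
      using c by (simp add: field_simps power2_eq_square)
    finally have "- (c / 2 + (X (Suc n) \<omega>)\<^sup>2 / (2 * c)) \<le> X (Suc n) \<omega>" by simp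
    moreover have "(X (Suc n) \<omega>)\<^sup>2 / (2 * c) \<le> ?V (Suc n) / (2 * c)"
      using c V0 unfolding V by (intro divide_right_mono) auto
    ultimately have "- (c / 2 + ?V (Suc n) / (2 * c)) \<le> ?U (Suc n)"
      using U by linarith
    moreover have "0 \<le> rw_S X (Suc n) \<omega>" if "alive (Suc (Suc n)) \<omega>"
      using that by (subst (asm) alive_Suc) auto
    ultimately show ?thesis
      using U by (simp add: rw_S_Suc)
  next
    case False
    then have "\<not> alive (Suc (Suc n)) \<omega>" using alive_antimono by fastforce
    then show ?thesis using False Suc.IH by simp
  qed
qed

text \<open>Wald's identity, one step at a time.\<close>

lemma
  assumes j: "j \<ge> 1" and f: "f \<in> borel_measurable borel" and int: "integrable M (\<lambda>\<omega>. f (X 1 \<omega>) :: real)"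
  shows expectation_alive_mult:
      "expectation (\<lambda>\<omega>. of_bool (alive j \<omega>) * f (X j \<omega>)) = alive_prob j * expectation (\<lambda>\<omega>. f (X 1 \<omega>))"
    and integrable_alive_mult: "integrable M (\<lambda>\<omega>. of_bool (alive j \<omega>) * f (X j \<omega>))"
proof -
  have 1: "(\<lambda>\<omega>. of_bool (alive j \<omega>) :: real) \<in> borel_measurable (coord_algebra {1..<j})"
    using alive_coord_measurable[of j] by measurable
  have 2: "(\<lambda>\<omega>. f (X j \<omega>)) \<in> borel_measurable (coord_algebra {j})"
    by (rule measurable_compose[OF X_coord_measurable f]) simp
  have 3: "integrable M (\<lambda>\<omega>. of_bool (alive j \<omega>) :: real)"
    by (rule integrable_const_bound[where B=1]) auto
  have 4: "integrable M (\<lambda>\<omega>. f (X j \<omega>))"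
    using integrable_step[OF j f] int by simp
  have 5: "{1..<j} \<inter> {j} = {}" "{1..<j} \<subseteq> {1..}" "{j} \<subseteq> {1..}" using j by auto
  show "integrable M (\<lambda>\<omega>. of_bool (alive j \<omega>) * f (X j \<omega>))"
    by (rule expectation_mult_coord(2)[OF 5 1 2 3 4])
  show "expectation (\<lambda>\<omega>. of_bool (alive j \<omega>) * f (X j \<omega>)) =
      alive_prob j * expectation (\<lambda>\<omega>. f (X 1 \<omega>))"
    using expectation_mult_coord(1)[OF 5 1 2 3 4] expectation_step[OF j f]
    by (simp add: expectation_of_bool alive_prob_def)
qed

text \<open>Expectations in \<open>stopped_sum_lower\<close> give a T \<le> c / 2 + T s / (2 c) for
  the partial sum \<open>T\<close> of the series for E \<tau>.\<close>

lemma sum_alive_prob_le: "(\<Sum>j\<in>{1..n}. alive_prob j) \<le> (second_moment + 1) / a\<^sup>2"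
proof -
  define s where "s = second_moment + 1"
  \<comment> \<open>With this value T s / (2 c) is a T / 2 and can be absorbed on the left. The 1
    added in \<open>s\<close> makes \<open>c\<close> positive.\<close>
  define c where "c = s / a"
  define T where "T = (\<Sum>j\<in>{1..n}. alive_prob j)"
  have s: "s > 0" and c: "c > 0"
    using second_moment_nonneg a_pos by (auto simp: s_def c_def)
  have T0: "T \<ge> 0" unfolding T_def by (intro sum_nonneg alive_prob_nonneg)
  let ?U = "\<lambda>\<omega>. \<Sum>j\<in>{1..n}. of_bool (alive j \<omega>) * X j \<omega>"
  let ?V = "\<lambda>\<omega>. \<Sum>j\<in>{1..n}. of_bool (alive j \<omega>) * (X j \<omega>)\<^sup>2"
  have iU: "integrable M (\<lambda>\<omega>. of_bool (alive j \<omega>) * X j \<omega>)"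
    and eU: "expectation (\<lambda>\<omega>. of_bool (alive j \<omega>) * X j \<omega>) = alive_prob j * (- a)"
    and iV: "integrable M (\<lambda>\<omega>. of_bool (alive j \<omega>) * (X j \<omega>)\<^sup>2)"
    and eV: "expectation (\<lambda>\<omega>. of_bool (alive j \<omega>) * (X j \<omega>)\<^sup>2) = alive_prob j * second_moment"
    if "j \<in> {1..n}" for j
    using that expectation_alive_mult[of j "\<lambda>z. z"] expectation_alive_mult[of j "\<lambda>z. z\<^sup>2"]
      integrable_alive_mult[of j "\<lambda>z. z"] integrable_alive_mult[of j "\<lambda>z. z\<^sup>2"]
      integrable_X1 X_square_integrable X_mean
    by (simp_all add: second_moment_def)
  have EU: "expectation ?U = T * (- a)"
    unfolding T_def sum_distrib_right
    by (rule trans[OF Bochner_Integration.integral_sum[OF iU] sum.cong[OF refl eU]])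
  have EV: "expectation ?V = T * second_moment"
    unfolding T_def sum_distrib_right
    by (rule trans[OF Bochner_Integration.integral_sum[OF iV] sum.cong[OF refl eV]])
  have IU: "integrable M ?U" and IV: "integrable M ?V"
    by (rule Bochner_Integration.integrable_sum[OF iU] Bochner_Integration.integrable_sum[OF iV]; simp)+
  have "- (c / 2 + T * second_moment / (2 * c)) = - (c / 2 + expectation ?V / (2 * c))"
    by (simp only: EV)
  also have "\<dots> = expectation (\<lambda>\<omega>. - (c / 2 + ?V \<omega> / (2 * c)))"
    using IV by (simp add: prob_space del: sum_of_bool_mult_eq sum_mult_of_bool_eq)
  also have "\<dots> \<le> expectation ?U"
    by (intro integral_mono IU stopped_sum_lower[OF c, THEN conjunct2] Bochner_Integration.integrable_minus
        Bochner_Integration.integrable_add Bochner_Integration.integrable_divide IV) auto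
  finally have "a * T \<le> c / 2 + T * second_moment / (2 * c)"
    using EU by (simp add: mult.commute)
  also have "\<dots> \<le> c / 2 + T * s / (2 * c)"
    using c T0 by (intro add_left_mono divide_right_mono mult_left_mono) (auto simp: s_def)
  also have "T * s / (2 * c) = a * T / 2"
    using s a_pos by (simp add: c_def)
  finally have "a * T \<le> c" by simp
  then have "T \<le> s / a\<^sup>2"
    using a_pos by (simp add: c_def field_simps power2_eq_square)
  then show ?thesis
    by (simp only: T_def s_def)
qed

lemma summable_alive_prob: "summable (\<lambda>j. alive_prob (Suc j))"
proof (rule summableI_nonneg_bounded)
  show "(\<Sum>i<n. alive_prob (Suc i)) \<le> (second_moment + 1) / a\<^sup>2" for n
    using sum_alive_prob_le[of n] by (simp add: sum.atLeast1_atMost_eq)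
qed (rule alive_prob_nonneg)

definition mean_length :: real where
  "mean_length = (\<Sum>j. alive_prob (Suc j))"

lemma mean_length_nonneg: "0 \<le> mean_length"
  unfolding mean_length_def by (intro suminf_nonneg summable_alive_prob alive_prob_nonneg)

text \<open>The probability of never hitting is below every \<open>alive_prob (Suc j)\<close>, and
  these tend to zero as terms of a convergent series.\<close>

lemma AE_hit: "AE \<omega> in M. \<exists>n\<ge>1. rw_S X n \<omega> \<le> 0"
proof -
  let ?B = "{\<omega> \<in> space M. \<forall>n\<ge>1. rw_S X n \<omega> > 0}"
  have [measurable]: "?B \<in> events" by measurable
  have le: "prob ?B \<le> alive_prob (Suc j)" for j
    unfolding alive_prob_def by (intro finite_measure_mono) (auto simp: alive_def)
  have "(\<lambda>j. alive_prob (Suc j)) \<longlonglongrightarrow> 0"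
    by (rule summable_LIMSEQ_zero[OF summable_alive_prob])
  then have "prob ?B \<le> 0"
    by (rule LIMSEQ_le_const) (use le in auto)
  then have "prob ?B = 0"
    using measure_nonneg[of M ?B] by linarith
  then have "AE \<omega> in M. \<omega> \<notin> ?B"
    by (simp only: prob_eq_0[OF \<open>?B \<in> events\<close>])
  with AE_space show ?thesis
    by eventually_elim (unfold not_less[symmetric] mem_Collect_eq, blast)
qed

lemma alive_iff_le_tau:
  assumes "\<exists>n\<ge>1. rw_S X n \<omega> \<le> 0"
  shows "alive j \<omega> \<longleftrightarrow> j \<le> rw_tau X \<omega>"
proof -
  let ?P = "\<lambda>n. 1 \<le> n \<and> rw_S X n \<omega> \<le> 0"
  have P: "?P (rw_tau X \<omega>)"
    unfolding rw_tau_def by (rule LeastI_ex[of ?P]) (use assms in blast)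
  have L: "\<not> ?P i" if "i < rw_tau X \<omega>" for i
    using not_less_Least[of i ?P] that unfolding rw_tau_def by blast
  show ?thesis
  proof
    assume al: "alive j \<omega>"
    show "j \<le> rw_tau X \<omega>"
    proof (rule ccontr)
      assume "\<not> j \<le> rw_tau X \<omega>"
      then have "rw_tau X \<omega> \<in> {1..<j}" using P by auto
      then show False using al P by (auto simp: alive_def not_le[symmetric])
    qed
  next
    assume j: "j \<le> rw_tau X \<omega>"
    have "rw_S X i \<omega> > 0" if "i \<in> {1..<j}" for i
      using L[of i] that j by (simp add: not_le)
    then show "alive j \<omega>" by (simp add: alive_def)
  qed
qed

text \<open>E \<tau> is the sum of P(\<tau> \<ge> j), by exchanging sum and nonnegative integral.
  The computation yields equality; the lower bound uses this direction.\<close>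

lemma expectation_tau_le: "expectation (\<lambda>\<omega>. real (rw_tau X \<omega>)) \<le> mean_length"
proof -
  have [measurable]: "(\<lambda>\<omega>. real (rw_tau X \<omega>)) \<in> borel_measurable M"
    unfolding rw_tau_def by measurable
  have "(\<integral>\<^sup>+ \<omega>. ennreal (real (rw_tau X \<omega>)) \<partial>M) = (\<integral>\<^sup>+ \<omega>. (\<Sum>j. ennreal (of_bool (alive (Suc j) \<omega>))) \<partial>M)"
  proof (rule nn_integral_cong_AE, use AE_hit in eventually_elim)
    fix \<omega> assume hit: "\<exists>n\<ge>1. rw_S X n \<omega> \<le> 0"
    have "(\<Sum>j. ennreal (of_bool (alive (Suc j) \<omega>))) =
        (\<Sum>j<rw_tau X \<omega>. ennreal (of_bool (alive (Suc j) \<omega>)))"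
      using alive_iff_le_tau[OF hit] by (intro suminf_finite) auto
    also have "\<dots> = (\<Sum>j<rw_tau X \<omega>. 1)"
      using alive_iff_le_tau[OF hit] by (intro sum.cong) auto
    finally show "ennreal (real (rw_tau X \<omega>)) = (\<Sum>j. ennreal (of_bool (alive (Suc j) \<omega>)))"
      by (simp add: ennreal_of_nat_eq_real_of_nat)
  qed
  also have "\<dots> = (\<Sum>j. \<integral>\<^sup>+ \<omega>. ennreal (of_bool (alive (Suc j) \<omega>)) \<partial>M)"
    by (intro nn_integral_suminf) measurable
  also have "\<dots> = (\<Sum>j. ennreal (alive_prob (Suc j)))"
  proof (intro arg_cong[of _ _ suminf] ext)
    fix j
    have "(\<integral>\<^sup>+ \<omega>. ennreal (of_bool (alive (Suc j) \<omega>)) \<partial>M) =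
        ennreal (expectation (\<lambda>\<omega>. of_bool (alive (Suc j) \<omega>)))"
      by (intro nn_integral_eq_integral integrable_const_bound[where B=1]) auto
    then show "(\<integral>\<^sup>+ \<omega>. ennreal (of_bool (alive (Suc j) \<omega>)) \<partial>M) = ennreal (alive_prob (Suc j))"
      by (simp add: expectation_of_bool alive_prob_def)
  qed
  also have "\<dots> = ennreal mean_length"
    unfolding mean_length_def
    by (intro suminf_ennreal2 alive_prob_nonneg summable_alive_prob)
  finally have "expectation (\<lambda>\<omega>. real (rw_tau X \<omega>)) = mean_length"
    by (subst integral_eq_nn_integral) (auto simp: mean_length_nonneg)
  then show ?thesis by simp
qed

text \<open>Whether time \<open>j\<close> is reached is independent of \<open>X j\<close>, so the
  union bound adds up to E \<tau> times the tail, although the number of steps is unbounded.\<close>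

lemma prob_big_jump_le:
  "prob {\<omega> \<in> space M. \<exists>j\<ge>1. alive j \<omega> \<and> X j \<omega> > b} \<le> mean_length * Fbar M X b"
proof -
  let ?E = "\<lambda>j. {\<omega> \<in> space M. alive (Suc j) \<omega> \<and> X (Suc j) \<omega> > b}"
  have pE: "prob (?E j) = alive_prob (Suc j) * Fbar M X b" for j
    unfolding alive_prob_def prob_step_gt[of "Suc j" b, simplified, symmetric]
    by (intro prob_conj_coord[where I = "{1..<Suc j}" and J = "{Suc j}"] alive_coord_measurable
        borel_measurable_pred_less X_coord_measurable) auto
  have sum: "summable (\<lambda>j. alive_prob (Suc j) * Fbar M X b)"
    by (intro summable_mult2 summable_alive_prob)
  have "prob {\<omega> \<in> space M. \<exists>j\<ge>1. alive j \<omega> \<and> X j \<omega> > b} \<le> prob (\<Union>j. ?E j)"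
  proof (intro finite_measure_mono subsetI)
    fix \<omega> assume "\<omega> \<in> {\<omega> \<in> space M. \<exists>j\<ge>1. alive j \<omega> \<and> X j \<omega> > b}"
    then obtain j where "j \<ge> 1" "alive j \<omega>" "X j \<omega> > b" "\<omega> \<in> space M" by auto
    then show "\<omega> \<in> (\<Union>j. ?E j)" by (intro UN_I[of "j - 1"]) auto
  qed measurable
  also have "\<dots> \<le> (\<Sum>j. prob (?E j))"
    by (rule finite_measure_subadditive_countably) (auto simp: pE sum)
  also have "\<dots> = mean_length * Fbar M X b"
    by (simp add: pE mean_length_def suminf_mult2[OF summable_alive_prob])
  finally show ?thesis .
qed

end

section \<open>Truncated steps and elementary exponential inequalities\<close>

definition trunc_at :: "real \<Rightarrow> real \<Rightarrow> real" where
  "trunc_at b z = (if z \<le> b then z else 0)"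

definition clip_between :: "real \<Rightarrow> real \<Rightarrow> real \<Rightarrow> real" where
  "clip_between b c z = (if b < z \<and> z \<le> c then z else 0)"

lemma trunc_at_measurable [measurable]: "trunc_at b \<in> borel_measurable borel"
  unfolding trunc_at_def[abs_def] by measurable

lemma clip_between_measurable [measurable]: "clip_between b c \<in> borel_measurable borel"
  unfolding clip_between_def[abs_def] by measurable

text \<open>Truncation sets large steps to zero instead of capping them at \<open>b\<close>, so the
  steps between \<open>b\<close> and \<open>c\<close> reappear in full in a separate nonnegative
  part.\<close>

lemma trunc_at_plus_clip_between: "z \<le> c \<Longrightarrow> b \<le> c \<Longrightarrow> trunc_at b z + clip_between b c z = z"
  by (auto simp: trunc_at_def clip_between_def)

lemma clip_between_nonneg: "0 \<le> b \<Longrightarrow> 0 \<le> clip_between b c z"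
  by (auto simp: clip_between_def)

text \<open>For u = - v < 0 it follows from (1 + v) (1 - v + v^2) = 1 + v^3 \<ge> 1 and 1 + v \<le>
  exp v. Arbitrarily negative \<open>u\<close> are covered because steps may be unbounded
  below.\<close>

lemma exp_le_quadratic:
  fixes u :: real
  assumes "u \<le> 1"
  shows "exp u \<le> 1 + u + u\<^sup>2"
proof (cases "u \<ge> 0")
  case True
  then show ?thesis using assms exp_bound by blast
next
  case False
  define v where "v = - u"
  have v: "v > 0" using False by (simp add: v_def)
  have "1 \<le> 1 + v ^ 3" using v by simp
  also have "\<dots> = (1 + v) * (1 - v + v\<^sup>2)" by (simp add: power2_eq_square power3_eq_cube algebra_simps)
  also have "\<dots> \<le> exp v * (1 - v + v\<^sup>2)"
  proof (rule mult_right_mono)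
    have "0 \<le> (1 - v)\<^sup>2 + v" using v by (intro add_nonneg_nonneg) auto
    then show "0 \<le> 1 - v + v\<^sup>2" by (simp add: power2_eq_square algebra_simps)
  qed (rule exp_ge_add_one_self)
  finally have "exp (- v) \<le> 1 - v + v\<^sup>2"
    by (simp add: exp_minus field_simps)
  then show ?thesis by (simp add: v_def)
qed

text \<open>Up to 1 / l the quadratic bound applies, between 1 / l and \<open>b\<close> the
  exponential itself is kept, and beyond \<open>b\<close> the left side is 1. The linear term
  carries the untruncated \<open>z\<close>, so that its mean is exactly - a s.\<close>

lemma exp_trunc_at_le:
  assumes "0 \<le> s" "s \<le> l" "0 < l" "0 \<le> b"
  shows "exp (s * trunc_at b z) \<le> 1 + s * z + l\<^sup>2 * z\<^sup>2 + exp (l * z) * of_bool (1 / l < z \<and> z \<le> b)"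
proof -
  have sq: "(s * z)\<^sup>2 \<le> l\<^sup>2 * z\<^sup>2"
    using assms by (auto simp: power_mult_distrib intro!: mult_right_mono power_mono)
  consider "z > b" | "z \<le> b" "z \<le> 1 / l" | "z \<le> b" "1 / l < z" by linarith
  then show ?thesis
  proof cases
    case 1
    then show ?thesis using assms by (simp add: trunc_at_def)
  next
    case 2
    have "s * z \<le> 1"
    proof (cases "z \<ge> 0")
      case True
      then have "s * z \<le> l * z" using assms by (intro mult_right_mono) auto
      also have "\<dots> \<le> 1" using 2 assms by (simp add: field_simps)
      finally show ?thesis .
    next
      case False
      then show ?thesis using assms mult_nonneg_nonpos[of s z] by simp
    qed
    from exp_le_quadratic[OF this] 2 sq show ?thesis by (simp add: trunc_at_def)
  next
    case 3
    have z: "0 < z" using 3 assms by (meson less_trans zero_less_divide_1_iff)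
    have "exp (s * z) \<le> exp (l * z)" using assms z by simp
    moreover have "0 \<le> s * z" "0 \<le> l\<^sup>2 * z\<^sup>2" using assms z by auto
    ultimately have "exp (s * z) \<le> 1 + s * z + l\<^sup>2 * z\<^sup>2 + exp (l * z)" by linarith
    then show ?thesis using 3 by (simp add: trunc_at_def)
  qed
qed

text \<open>The difference of the two sides is (y - a n)^2 / (2 a n). It removes the excursion
  length \<open>n\<close> from the Chernoff exponent.\<close>

lemma quadratic_tangent:
  fixes y n a :: real
  assumes "a > 0" "n > 0"
  shows "y \<le> y\<^sup>2 / (2 * a) / n + a * n / 2"
proof -
  have "0 \<le> (y - a * n)\<^sup>2 / (2 * a * n)" using assms by simp
  also have "\<dots> = y\<^sup>2 / (2 * a) / n + a * n / 2 - y"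
    using assms by (simp add: field_simps power2_eq_square)
  finally show ?thesis by simp
qed

context negative_drift_walk begin

subsection \<open>Exponential bounds for truncated steps\<close>

definition exp_tail :: "real \<Rightarrow> real \<Rightarrow> real \<Rightarrow> real" where
  "exp_tail l c b = expectation (\<lambda>\<omega>. exp (l * X 1 \<omega>) * of_bool (c < X 1 \<omega> \<and> X 1 \<omega> \<le> b))"

text \<open>Bounds the excess over the drift term in the log-moment generating function of a
  truncated step, uniformly for tilts between 0 and \<open>l\<close>.\<close>

definition mgf_error :: "real \<Rightarrow> real \<Rightarrow> real" where
  "mgf_error l b = l\<^sup>2 * second_moment + exp_tail l (1 / l) b"

lemma integrable_exp_tail:
  "0 < l \<Longrightarrow> integrable M (\<lambda>\<omega>. exp (l * X 1 \<omega>) * of_bool (c < X 1 \<omega> \<and> X 1 \<omega> \<le> b))"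
  by (rule integrable_const_bound[where B = "exp (l * b)"]) auto

lemma exp_tail_nonneg: "0 \<le> exp_tail l c b"
  unfolding exp_tail_def by (intro Bochner_Integration.integral_nonneg) auto

lemma mgf_error_nonneg: "0 \<le> mgf_error l b"
  unfolding mgf_error_def using exp_tail_nonneg second_moment_nonneg by simp

lemma integrable_exp_trunc_at:
  assumes "0 \<le> s" "0 \<le> b"
  shows "integrable M (\<lambda>\<omega>. exp (s * trunc_at b (X 1 \<omega>)))"
proof (rule integrable_const_bound[where B = "exp (s * b)"])
  have "exp (s * trunc_at b z) \<le> exp (s * b)" for z
    using assms by (auto simp: trunc_at_def intro: mult_left_mono)
  then show "AE \<omega> in M. norm (exp (s * trunc_at b (X 1 \<omega>))) \<le> exp (s * b)" by auto
qed measurable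

lemma expectation_exp_trunc_at_le:
  assumes "0 \<le> s" "s \<le> l" "0 < l" "0 \<le> b"
  shows "expectation (\<lambda>\<omega>. exp (s * trunc_at b (X 1 \<omega>))) \<le> exp (- a * s + mgf_error l b)"
proof -
  let ?R = "\<lambda>\<omega>. 1 + s * X 1 \<omega> + l\<^sup>2 * (X 1 \<omega>)\<^sup>2 + exp (l * X 1 \<omega>) * of_bool (1 / l < X 1 \<omega> \<and> X 1 \<omega> \<le> b)"
  note ints = integrable_X1 X_square_integrable integrable_exp_tail[OF assms(3), of "1 / l" b]
  have "expectation (\<lambda>\<omega>. exp (s * trunc_at b (X 1 \<omega>))) \<le> expectation ?R"
    by (intro integral_mono integrable_exp_trunc_at exp_trunc_at_le assms
        Bochner_Integration.integrable_add integrable_mult_right ints integrable_const)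
  also have "\<dots> = 1 + (- a * s + mgf_error l b)"
  proof -
    have "expectation (\<lambda>\<omega>. 1 + s * X 1 \<omega> + l\<^sup>2 * (X 1 \<omega>)\<^sup>2) = 1 + s * (- a) + l\<^sup>2 * second_moment"
      using integrable_X1 X_square_integrable X_mean
      by (simp add: second_moment_def prob_space)
    moreover have "expectation ?R = expectation (\<lambda>\<omega>. 1 + s * X 1 \<omega> + l\<^sup>2 * (X 1 \<omega>)\<^sup>2) + exp_tail l (1 / l) b"
      unfolding exp_tail_def
      by (intro Bochner_Integration.integral_add Bochner_Integration.integrable_add
          integrable_mult_right ints integrable_const)
    ultimately show ?thesis by (simp add: mgf_error_def)
  qed
  also have "\<dots> \<le> exp (- a * s + mgf_error l b)" by (rule exp_ge_add_one_self)
  finally show ?thesis .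
qed

lemma prob_le_exp:
  assumes [measurable]: "Y \<in> borel_measurable M" and int: "integrable M (\<lambda>\<omega>. exp (l * Y \<omega>))" and "0 < l"
  shows "prob {\<omega> \<in> space M. Y \<omega> > z} \<le> exp (- l * z) * expectation (\<lambda>\<omega>. exp (l * Y \<omega>))"
proof -
  have "prob {\<omega> \<in> space M. Y \<omega> > z} = expectation (\<lambda>\<omega>. of_bool (Y \<omega> > z))"
    by (simp add: expectation_of_bool)
  also have "\<dots> \<le> expectation (\<lambda>\<omega>. exp (- l * z) * exp (l * Y \<omega>))"
  proof (intro integral_mono integrable_mult_right int)
    show "integrable M (\<lambda>\<omega>. of_bool (Y \<omega> > z) :: real)"
      by (rule integrable_const_bound[where B=1]) auto
    show "of_bool (Y \<omega> > z) \<le> exp (- l * z) * exp (l * Y \<omega>)" for \<omega>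
      using \<open>0 < l\<close> by (simp flip: exp_add)
  qed
  finally show ?thesis by simp
qed

text \<open>Weights in [0, 1] keep every individual tilt \<open>l * w j\<close> at most
  \<open>l\<close>, so one error term serves both the area form, with weights (n - j) / n, and the
  plain sum, with weights 1.\<close>

lemma chernoff_trunc_at:
  assumes w: "\<And>j. j \<in> {1..n} \<Longrightarrow> 0 \<le> w j \<and> w j \<le> 1" and l: "0 < l" and b: "0 \<le> b"
  shows "prob {\<omega> \<in> space M. (\<Sum>j\<in>{1..n}. w j * trunc_at b (X j \<omega>)) > z}
    \<le> exp (- l * z - a * l * (\<Sum>j\<in>{1..n}. w j) + real n * mgf_error l b)"
proof -
  let ?Y = "\<lambda>\<omega>. \<Sum>j\<in>{1..n}. w j * trunc_at b (X j \<omega>)"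
  let ?f = "\<lambda>j z. exp (l * w j * trunc_at b z)"
  have eq: "exp (l * ?Y \<omega>) = (\<Prod>j\<in>{1..n}. ?f j (X j \<omega>))" for \<omega>
    by (simp add: exp_sum sum_distrib_left mult.assoc)
  have int: "integrable M (\<lambda>\<omega>. ?f j (X 1 \<omega>))" if "j \<in> {1..n}" for j
    using w[OF that] l b by (intro integrable_exp_trunc_at) auto
  have "expectation (\<lambda>\<omega>. exp (l * ?Y \<omega>)) = (\<Prod>j\<in>{1..n}. expectation (\<lambda>\<omega>. ?f j (X 1 \<omega>)))"
    unfolding eq by (rule expectation_prod_steps(1)[OF _ int]) auto
  also have "\<dots> \<le> (\<Prod>j\<in>{1..n}. exp (- a * (l * w j) + mgf_error l b))"
  proof (rule prod_mono, intro conjI)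
    fix j assume j: "j \<in> {1..n}"
    show "0 \<le> expectation (\<lambda>\<omega>. ?f j (X 1 \<omega>))" by (rule Bochner_Integration.integral_nonneg) simp
    show "expectation (\<lambda>\<omega>. ?f j (X 1 \<omega>)) \<le> exp (- a * (l * w j) + mgf_error l b)"
      using w[OF j] l b by (intro expectation_exp_trunc_at_le) (auto intro: mult_left_le)
  qed
  also have "\<dots> = exp (- a * l * (\<Sum>j\<in>{1..n}. w j) + real n * mgf_error l b)"
    by (simp add: exp_sum[symmetric] sum.distrib sum_distrib_left sum_negf mult.assoc sum_subtractf)
  finally have E: "expectation (\<lambda>\<omega>. exp (l * ?Y \<omega>)) \<le> exp (- a * l * (\<Sum>j\<in>{1..n}. w j) + real n * mgf_error l b)" .
  have "prob {\<omega> \<in> space M. ?Y \<omega> > z} \<le> exp (- l * z) * expectation (\<lambda>\<omega>. exp (l * ?Y \<omega>))"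
  proof (rule prob_le_exp[OF _ _ l])
    show "integrable M (\<lambda>\<omega>. exp (l * ?Y \<omega>))"
      unfolding eq by (rule expectation_prod_steps(2)[OF _ int]) auto
  qed measurable
  also have "\<dots> \<le> exp (- l * z) * exp (- a * l * (\<Sum>j\<in>{1..n}. w j) + real n * mgf_error l b)"
    by (intro mult_left_mono E) auto
  finally show ?thesis by (simp add: exp_add[symmetric] algebra_simps)
qed

text \<open>On a cell of length 1 / l the exponential grows by a factor at most e, so its value at
  the left endpoint times \<open>exp 1\<close> suffices; the indicator of the cell is enlarged to
  that of a half-line.\<close>

lemma exp_tail_le_sum:
  assumes l: "0 < l" and N: "b \<le> c + real N / l"
  shows "exp_tail l c b \<le> exp 1 * (\<Sum>i<N. exp (l * (c + real i / l)) * Fbar M X (c + real i / l))"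
proof -
  let ?t = "\<lambda>i. c + real i / l"
  let ?R = "\<lambda>z. \<Sum>i<N. exp 1 * exp (l * ?t i) * of_bool (z > ?t i)"
  have pt: "exp (l * z) * of_bool (c < z \<and> z \<le> b) \<le> ?R z" for z
  proof (cases "c < z \<and> z \<le> b")
    case True
    \<comment> \<open>Ceiling minus one makes cells open on the left and closed on the right, so
      that \<open>z\<close> exceeds its grid point strictly, as \<open>Fbar\<close> demands.\<close>
    define i where "i = nat (\<lceil>l * (z - c)\<rceil> - 1)"
    have pos: "0 < l * (z - c)" using True l by simp
    then have i: "real i < l * (z - c)" "l * (z - c) \<le> real i + 1"
      unfolding i_def by linarith+
    have "l * (z - c) \<le> real N"
    proof -
      have "l * (z - c) \<le> l * (real N / l)" using True N l by (intro mult_left_mono) auto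
      then show ?thesis using l by simp
    qed
    with i have iN: "i < N" by linarith
    have "l * ?t i = l * c + real i" using l by (simp add: distrib_left)
    then have "exp (l * z) \<le> exp (1 + l * ?t i)"
      using i by (simp add: algebra_simps)
    also have "\<dots> = exp 1 * exp (l * ?t i) * of_bool (z > ?t i)"
    proof -
      have "z > ?t i" using i l by (simp add: field_simps)
      then show ?thesis by (simp add: exp_add)
    qed
    also have "\<dots> \<le> ?R z"
      using iN by (intro member_le_sum) auto
    finally show ?thesis using True by simp
  qed (auto intro!: sum_nonneg)
  have int: "integrable M (\<lambda>\<omega>. of_bool (X 1 \<omega> > t) :: real)" for t
    by (rule integrable_const_bound[where B=1]) auto
  have "exp_tail l c b \<le> expectation (\<lambda>\<omega>. ?R (X 1 \<omega>))"
    unfolding exp_tail_def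
    by (intro integral_mono pt integrable_exp_tail l Bochner_Integration.integrable_sum
        integrable_mult_right int)
  also have "\<dots> = (\<Sum>i<N. expectation (\<lambda>\<omega>. exp 1 * exp (l * ?t i) * of_bool (X 1 \<omega> > ?t i)))"
    by (intro Bochner_Integration.integral_sum integrable_mult_right int)
  also have "\<dots> = exp 1 * (\<Sum>i<N. exp (l * ?t i) * Fbar M X (?t i))"
    unfolding sum_distrib_left
    by (intro sum.cong refl) (simp add: expectation_of_bool Fbar_def)
  finally show ?thesis .
qed

section \<open>Reduction of the area event to linear forms in the steps\<close>

lemma sum_rw_S: "(\<Sum>k<n. rw_S X k \<omega>) = (\<Sum>j\<in>{1..n}. (real n - real j) * X j \<omega>)"
proof (induction n)
  case (Suc n)
  have "(\<Sum>k<Suc n. rw_S X k \<omega>) = (\<Sum>j\<in>{1..n}. (real n - real j) * X j \<omega>) + (\<Sum>j\<in>{1..n}. X j \<omega>)"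
    using Suc by (simp add: rw_S_def)
  also have "\<dots> = (\<Sum>j\<in>{1..n}. (real (Suc n) - real j) * X j \<omega>)"
    unfolding sum.distrib[symmetric] by (intro sum.cong) (auto simp: algebra_simps)
  finally show ?case by simp
qed simp

text \<open>Let n = \<tau>. If n \<le> n0, dividing the area by \<open>n\<close> gives weights in
  [0, 1], and the clipped steps contribute at most \<open>v\<close> once their weights are raised to
  1. If n > n0, positivity of the walk at time \<open>n0\<close> forces the plain truncated sum
  above - v.\<close>

lemma area_gt_cases:
  assumes A: "rw_A X \<omega> > x" and x: "0 \<le> x" and n0: "1 \<le> n0"
    and b: "0 \<le> b" "b \<le> c"
    and nojump: "\<not> (\<exists>j\<ge>1. alive j \<omega> \<and> X j \<omega> > c)"
    and v: "(\<Sum>j\<in>{1..n0}. clip_between b c (X j \<omega>)) \<le> v"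
  shows "(\<exists>n\<in>{1..n0}. (\<Sum>j\<in>{1..n}. (real n - real j) / real n * trunc_at b (X j \<omega>)) > x / real n - v)
    \<or> (\<Sum>j\<in>{1..n0}. 1 * trunc_at b (X j \<omega>)) > - v"
proof -
  have hit: "\<exists>n\<ge>1. rw_S X n \<omega> \<le> 0"
    using A x unfolding rw_A_def by (auto split: if_splits)
  define n where "n = rw_tau X \<omega>"
  have alive: "alive j \<omega> \<longleftrightarrow> j \<le> n" for j
    unfolding n_def by (rule alive_iff_le_tau[OF hit])
  have An: "x < (\<Sum>j\<in>{1..n}. (real n - real j) * X j \<omega>)"
    using A hit unfolding rw_A_def n_def sum_rw_S by simp
  have n1: "1 \<le> n" using alive[of 1] by simp
  have dec: "X j \<omega> = trunc_at b (X j \<omega>) + clip_between b c (X j \<omega>)" if "j \<in> {1..n}" for j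
    using that nojump alive[of j] b by (intro trunc_at_plus_clip_between[symmetric]) auto
  show ?thesis
  proof (cases "n \<le> n0")
    case True
    have "(\<Sum>j\<in>{1..n}. (real n - real j) * X j \<omega>)
        = (\<Sum>j\<in>{1..n}. (real n - real j) * trunc_at b (X j \<omega>)) + (\<Sum>j\<in>{1..n}. (real n - real j) * clip_between b c (X j \<omega>))"
      unfolding sum.distrib[symmetric] by (intro sum.cong refl, subst dec) (auto simp: algebra_simps)
    also have "(\<Sum>j\<in>{1..n}. (real n - real j) * clip_between b c (X j \<omega>)) \<le> (\<Sum>j\<in>{1..n}. real n * clip_between b c (X j \<omega>))"
      using b by (intro sum_mono mult_right_mono clip_between_nonneg) auto
    also have "\<dots> \<le> (\<Sum>j\<in>{1..n0}. real n * clip_between b c (X j \<omega>))"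
      using b True by (intro sum_mono2 mult_nonneg_nonneg clip_between_nonneg) auto
    also have "\<dots> \<le> real n * v"
      unfolding sum_distrib_left[symmetric] using v by (intro mult_left_mono) auto
    finally have "x < (\<Sum>j\<in>{1..n}. (real n - real j) * trunc_at b (X j \<omega>)) + real n * v"
      using An by simp
    moreover define s where "s = (\<Sum>j\<in>{1..n}. (real n - real j) * trunc_at b (X j \<omega>))"
    ultimately have "x / real n - v < s / real n"
      using n1 by (simp add: divide_simps) (simp add: algebra_simps)
    then show ?thesis
      using True n1 by (intro disjI1 bexI[of _ n]) (auto simp: s_def sum_divide_distrib)
  next
    case False
    then have "alive (Suc n0) \<omega>" using alive by simp
    then have "0 < rw_S X n0 \<omega>" using n0 by (simp add: alive_def)
    also have "rw_S X n0 \<omega> = (\<Sum>j\<in>{1..n0}. trunc_at b (X j \<omega>)) + (\<Sum>j\<in>{1..n0}. clip_between b c (X j \<omega>))"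
      unfolding rw_S_def sum.distrib[symmetric] using False by (intro sum.cong refl dec) auto
    finally show ?thesis using v by simp
  qed
qed

text \<open>By \<open>quadratic_tangent\<close> each length n \<le> n0 has exponent at most about -
  l (y - v), and n0 \<ge> 2 y / a makes survival beyond \<open>n0\<close> just as unlikely. A union
  bound over n0 + 1 such events remains, besides a jump above \<open>c\<close> and a large clipped
  sum.\<close>

lemma prob_area_le:
  assumes l: "0 < l" and b: "0 \<le> b" "b \<le> c" and v: "0 \<le> v" and y: "0 < y" and n0: "2 * y / a \<le> real n0"
  shows "prob {\<omega> \<in> space M. rw_A X \<omega> > y\<^sup>2 / (2 * a)} \<le> mean_length * Fbar M X c
    + prob {\<omega> \<in> space M. (\<Sum>j\<in>{1..n0}. clip_between b c (X j \<omega>)) > v}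
    + (real n0 + 1) * exp (- l * (y - v) + a * l / 2 + real n0 * mgf_error l b)"
proof -
  define x where "x = y\<^sup>2 / (2 * a)"
  define K where "K = exp (- l * (y - v) + a * l / 2 + real n0 * mgf_error l b)"
  have x: "0 \<le> x" unfolding x_def using a_pos by simp
  have an0: "2 * y \<le> a * real n0" using n0 a_pos by (simp add: field_simps)
  have n01: "1 \<le> n0"
  proof (rule ccontr)
    assume "\<not> 1 \<le> n0"
    then have "n0 = 0" by simp
    then show False using an0 y by simp
  qed
  let ?J = "{\<omega> \<in> space M. \<exists>j\<ge>1. alive j \<omega> \<and> X j \<omega> > c}"
  let ?Z = "{\<omega> \<in> space M. (\<Sum>j\<in>{1..n0}. clip_between b c (X j \<omega>)) > v}"
  let ?E = "\<lambda>n. {\<omega> \<in> space M. (\<Sum>j\<in>{1..n}. (real n - real j) / real n * trunc_at b (X j \<omega>)) > x / real n - v}"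
  let ?F = "{\<omega> \<in> space M. (\<Sum>j\<in>{1..n0}. 1 * trunc_at b (X j \<omega>)) > - v}"
  have E: "prob (?E n) \<le> K" if n: "n \<in> {1..n0}" for n
  proof -
    \<comment> \<open>The discrete weights add up to (n - 1) / 2 rather than n / 2; the missing half
      is the source of \<open>a * l / 2\<close> in the bound.\<close>
    have sw: "(\<Sum>j\<in>{1..n}. (real n - real j) / real n) = (real n - 1) / 2"
    proof -
      have "(\<Sum>j\<in>{1..n}. real n - real j) = real n * (real n - 1) / 2"
        by (induction n) (simp_all add: algebra_simps sum_subtractf)
      then show ?thesis using n by (simp add: sum_divide_distrib[symmetric])
    qed
    have "prob (?E n) \<le> exp (- l * (x / real n - v) - a * l * ((real n - 1) / 2) + real n * mgf_error l b)"
      unfolding sw[symmetric] using l b by (intro chernoff_trunc_at) auto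
    also have "\<dots> \<le> K"
    proof -
      have "l * y \<le> l * (x / real n + a * real n / 2)"
        using quadratic_tangent[of a "real n" y] a_pos n l unfolding x_def by (intro mult_left_mono) auto
      moreover have "real n * mgf_error l b \<le> real n0 * mgf_error l b"
        using n mgf_error_nonneg by (intro mult_right_mono) auto
      ultimately show ?thesis
        unfolding K_def by (simp add: algebra_simps add_divide_distrib diff_divide_distrib)
    qed
    finally show ?thesis .
  qed
  have F: "prob ?F \<le> K"
  proof -
    have "prob ?F \<le> exp (- l * (- v) - a * l * (\<Sum>j\<in>{1..n0}. 1) + real n0 * mgf_error l b)"
      using l b by (intro chernoff_trunc_at) auto
    also have "\<dots> \<le> K"
    proof -
      have "l * (2 * y) \<le> l * (a * real n0)" using an0 l by (intro mult_left_mono) auto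
      moreover have "0 \<le> l * y" "0 \<le> a * l / 2" using l y a_pos by auto
      ultimately have "- l * (- v) - a * l * real n0 \<le> - l * (y - v) + a * l / 2"
        by (simp add: algebra_simps)
      then show ?thesis unfolding K_def by simp
    qed
    finally show ?thesis .
  qed
  have "prob {\<omega> \<in> space M. rw_A X \<omega> > x} \<le> prob (?J \<union> (?Z \<union> ((\<Union>n\<in>{1..n0}. ?E n) \<union> ?F)))"
  proof (intro finite_measure_mono subsetI)
    fix \<omega> assume w: "\<omega> \<in> {\<omega> \<in> space M. rw_A X \<omega> > x}"
    show "\<omega> \<in> ?J \<union> (?Z \<union> ((\<Union>n\<in>{1..n0}. ?E n) \<union> ?F))"
    proof (cases "\<omega> \<in> ?J \<or> \<omega> \<in> ?Z")
      case False
      then have "\<not> (\<exists>j\<ge>1. alive j \<omega> \<and> X j \<omega> > c)" "(\<Sum>j\<in>{1..n0}. clip_between b c (X j \<omega>)) \<le> v"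
        using w by (auto simp: not_less)
      from area_gt_cases[OF _ x n01 b this] w show ?thesis by auto
    qed auto
  qed measurable
  also have "\<dots> \<le> prob ?J + (prob ?Z + (prob (\<Union>n\<in>{1..n0}. ?E n) + prob ?F))"
    by (intro order.trans[OF measure_Un_le] add_left_mono add_right_mono order_refl) measurable
  also have "prob (\<Union>n\<in>{1..n0}. ?E n) \<le> (\<Sum>n\<in>{1..n0}. prob (?E n))"
    by (intro finite_measure_subadditive_finite) auto
  also have "\<dots> \<le> (\<Sum>n\<in>{1..n0}. K)" by (intro sum_mono E)
  finally show ?thesis
    using prob_big_jump_le[of c] F unfolding x_def[symmetric] K_def[symmetric]
    by (simp add: algebra_simps)
qed

text \<open>The clipped steps can only add up to more than \<open>c\<close> if two of them are nonzero, hence the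
  square of \<open>exp_tail\<close>.\<close>
lemma prob_sum_clip_between_le:
  assumes b: "0 \<le> b" "b \<le> c" and mu: "0 < mu"
  shows "prob {\<omega> \<in> space M. (\<Sum>j\<in>{1..n}. clip_between b c (X j \<omega>)) > c}
    \<le> (real n)\<^sup>2 * (exp_tail mu b c)\<^sup>2 * (1 + exp_tail mu b c) ^ n * exp (- mu * c)"
proof -
  define q where "q = exp_tail mu b c"
  define e where "e = (\<lambda>z::real. exp (mu * z) * of_bool (b < z \<and> z \<le> c))"
  \<comment> \<open>Factors \<open>i\<close> and \<open>k\<close> are forced into the window (b, c],
    the others are plain exponentials; summing over ordered pairs then covers all ways of having two
    steps in the window.\<close>
  define h where "h = (\<lambda>i k j z. if j \<in> {i, k :: nat} then e z else exp (mu * clip_between b c z))"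
  define P where "P = {(i, k). i \<in> {1..n} \<and> k \<in> {1..n} \<and> i \<noteq> k}"
  have q0: "0 \<le> q" unfolding q_def by (rule exp_tail_nonneg)
  have h0: "0 \<le> h i k j z" for i k j z by (simp add: h_def e_def)
  have finP: "finite P"
    by (rule finite_subset[of _ "{1..n} \<times> {1..n}"]) (auto simp: P_def)
  have cardP: "real (card P) \<le> (real n)\<^sup>2"
  proof -
    have "card P \<le> card ({1..n} \<times> {1..n})"
      by (rule card_mono) (auto simp: P_def)
    then have "card P \<le> n * n" by (simp add: card_cartesian_product)
    then have "real (card P) \<le> real (n * n)" by (simp only: of_nat_le_iff)
    then show ?thesis by (simp add: power2_eq_square)
  qed
  have em [measurable]: "e \<in> borel_measurable borel" unfolding e_def by measurable
  have hm [measurable]: "h i k j \<in> borel_measurable borel" for i k j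
    by (cases "j \<in> {i, k}") (auto simp: h_def[abs_def])
  have le: "exp (mu * clip_between b c z) \<le> 1 + e z" for z
    by (auto simp: clip_between_def e_def)
  have ie: "integrable M (\<lambda>\<omega>. e (X 1 \<omega>))"
    unfolding e_def by (rule integrable_exp_tail[OF mu])
  have ic: "integrable M (\<lambda>\<omega>. exp (mu * clip_between b c (X 1 \<omega>)))"
    by (rule Bochner_Integration.integrable_bound[of M "\<lambda>\<omega>. 1 + e (X 1 \<omega>)"])
       (use ie le in \<open>auto simp: e_def\<close>)
  have ih: "integrable M (\<lambda>\<omega>. h i k j (X 1 \<omega>))" for i k j
    by (cases "j \<in> {i, k}") (use ie ic in \<open>auto simp: h_def\<close>)
  have Ee: "expectation (\<lambda>\<omega>. e (X 1 \<omega>)) = q"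
    by (simp add: q_def exp_tail_def e_def)
  have Ec: "expectation (\<lambda>\<omega>. exp (mu * clip_between b c (X 1 \<omega>))) \<le> 1 + q"
  proof -
    have "expectation (\<lambda>\<omega>. exp (mu * clip_between b c (X 1 \<omega>))) \<le> expectation (\<lambda>\<omega>. 1 + e (X 1 \<omega>))"
      by (intro integral_mono ic le Bochner_Integration.integrable_add ie integrable_const)
    also have "\<dots> = 1 + q"
      using ie Ee by (simp add: prob_space)
    finally show ?thesis .
  qed
  \<comment> \<open>The factor 1 + q is granted to \<open>i\<close> and \<open>k\<close> as well, so
    that the product closes up as q^2 (1 + q)^n.\<close>
  have Eh: "expectation (\<lambda>\<omega>. h i k j (X 1 \<omega>)) \<le> (if j \<in> {i, k} then q else 1) * (1 + q)" for i k j
  proof (cases "j \<in> {i, k}")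
    case True
    then have "expectation (\<lambda>\<omega>. h i k j (X 1 \<omega>)) = q" using Ee by (simp add: h_def)
    also have "q \<le> q * (1 + q)" using q0 by (simp add: distrib_left)
    finally show ?thesis using True by simp
  next
    case False
    then show ?thesis using Ec by (simp add: h_def)
  qed
  have prod: "expectation (\<lambda>\<omega>. \<Prod>j\<in>{1..n}. h i k j (X j \<omega>)) \<le> q\<^sup>2 * (1 + q) ^ n"
    and iprod: "integrable M (\<lambda>\<omega>. \<Prod>j\<in>{1..n}. h i k j (X j \<omega>))"
    if "(i, k) \<in> P" for i k
  proof -
    show "integrable M (\<lambda>\<omega>. \<Prod>j\<in>{1..n}. h i k j (X j \<omega>))"
      by (rule expectation_prod_steps(2)[OF hm ih])
    have "expectation (\<lambda>\<omega>. \<Prod>j\<in>{1..n}. h i k j (X j \<omega>)) = (\<Prod>j\<in>{1..n}. expectation (\<lambda>\<omega>. h i k j (X 1 \<omega>)))"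
      by (rule expectation_prod_steps(1)[OF hm ih])
    also have "\<dots> \<le> (\<Prod>j\<in>{1..n}. (if j \<in> {i, k} then q else 1) * (1 + q))"
      by (intro prod_mono conjI Eh Bochner_Integration.integral_nonneg h0)
    also have "\<dots> = (\<Prod>j\<in>{1..n}. if j \<in> {i, k} then q else 1) * (1 + q) ^ n"
      by (simp add: prod.distrib)
    also have "(\<Prod>j\<in>{1..n}. if j \<in> {i, k} then q else 1) = (\<Prod>j\<in>{1..n} \<inter> {i, k}. q)"
      by (rule prod.inter_restrict[symmetric]) simp
    also have "{1..n} \<inter> {i, k} = {i, k}" using that by (auto simp: P_def)
    also have "(\<Prod>j\<in>{i, k}. q) = q\<^sup>2" using that by (simp add: P_def power2_eq_square)
    finally show "expectation (\<lambda>\<omega>. \<Prod>j\<in>{1..n}. h i k j (X j \<omega>)) \<le> q\<^sup>2 * (1 + q) ^ n" .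
  qed
  let ?Y = "\<lambda>\<omega>. \<Sum>j\<in>{1..n}. clip_between b c (X j \<omega>)"
  let ?R = "\<lambda>\<omega>. exp (- mu * c) * (\<Sum>(i, k)\<in>P. \<Prod>j\<in>{1..n}. h i k j (X j \<omega>))"
  have pt: "of_bool (?Y \<omega> > c) \<le> ?R \<omega>" for \<omega>
  proof (cases "?Y \<omega> > c")
    case True
    let ?N = "{j \<in> {1..n}. clip_between b c (X j \<omega>) \<noteq> 0}"
    have "\<exists>i\<in>?N. \<exists>k\<in>?N. i \<noteq> k"
    proof (rule ccontr)
      assume no: "\<not> ?thesis"
      have "?Y \<omega> = (\<Sum>j\<in>?N. clip_between b c (X j \<omega>))"
        by (intro sum.mono_neutral_right) auto
      also have "\<dots> \<le> c"
      proof (cases "?N = {}")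
        case True
        then show ?thesis using b by (simp only: sum.empty)
      next
        case False
        then obtain i where i: "i \<in> ?N" by blast
        then have N: "?N = {i}" using no by blast
        have "(\<Sum>j\<in>?N. clip_between b c (X j \<omega>)) = clip_between b c (X i \<omega>)"
          unfolding N by simp
        also have "\<dots> \<le> c" using b by (auto simp: clip_between_def)
        finally show ?thesis .
      qed
      finally show False using True by simp
    qed
    then obtain i k where ik: "(i, k) \<in> P" "clip_between b c (X i \<omega>) \<noteq> 0" "clip_between b c (X k \<omega>) \<noteq> 0"
      by (auto simp: P_def)
    have "1 \<le> exp (mu * (?Y \<omega> - c))" using True mu by simp
    also have "\<dots> = exp (- mu * c) * exp (mu * ?Y \<omega>)"
      by (simp add: exp_add[symmetric] algebra_simps)
    also have "exp (mu * ?Y \<omega>) = (\<Prod>j\<in>{1..n}. exp (mu * clip_between b c (X j \<omega>)))"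
      by (simp add: exp_sum sum_distrib_left)
    also have "\<dots> = (\<Prod>j\<in>{1..n}. h i k j (X j \<omega>))"
      by (intro prod.cong refl) (use ik in \<open>auto simp: h_def e_def clip_between_def split: if_splits\<close>)
    also have "\<dots> \<le> (\<Sum>(i, k)\<in>P. \<Prod>j\<in>{1..n}. h i k j (X j \<omega>))"
      using member_le_sum[OF ik(1), of "\<lambda>(i, k). \<Prod>j\<in>{1..n}. h i k j (X j \<omega>)"] finP
      by (auto intro: prod_nonneg h0)
    finally show ?thesis using True by simp
  next
    case False
    have "0 \<le> (\<Sum>(i, k)\<in>P. \<Prod>j\<in>{1..n}. h i k j (X j \<omega>))"
      by (intro sum_nonneg) (auto intro: prod_nonneg h0)
    then show ?thesis using False by simp
  qed
  have iR: "integrable M (\<lambda>\<omega>. \<Sum>(i, k)\<in>P. \<Prod>j\<in>{1..n}. h i k j (X j \<omega>))"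
    using iprod by (intro Bochner_Integration.integrable_sum) (simp add: case_prod_beta')
  have "prob {\<omega> \<in> space M. ?Y \<omega> > c} = expectation (\<lambda>\<omega>. of_bool (?Y \<omega> > c))"
    by (simp add: expectation_of_bool)
  also have "\<dots> \<le> expectation ?R"
  proof (intro integral_mono pt integrable_mult_right iR)
    show "integrable M (\<lambda>\<omega>. of_bool (?Y \<omega> > c) :: real)"
      by (rule integrable_const_bound[where B=1]) auto
  qed
  also have "\<dots> = exp (- mu * c) * (\<Sum>(i, k)\<in>P. expectation (\<lambda>\<omega>. \<Prod>j\<in>{1..n}. h i k j (X j \<omega>)))"
  proof -
    have "expectation (\<lambda>\<omega>. \<Sum>(i, k)\<in>P. \<Prod>j\<in>{1..n}. h i k j (X j \<omega>))
        = (\<Sum>p\<in>P. expectation (\<lambda>\<omega>. case p of (i, k) \<Rightarrow> \<Prod>j\<in>{1..n}. h i k j (X j \<omega>)))"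
      using iprod by (intro Bochner_Integration.integral_sum) (simp add: case_prod_beta')
    then show ?thesis by (simp add: case_prod_beta')
  qed
  also have "\<dots> \<le> exp (- mu * c) * (\<Sum>(i, k)\<in>P. q\<^sup>2 * (1 + q) ^ n)"
    using prod by (intro mult_left_mono sum_mono) auto
  also have "\<dots> = real (card P) * (q\<^sup>2 * (1 + q) ^ n * exp (- mu * c))"
    by simp
  also have "\<dots> \<le> (real n)\<^sup>2 * (q\<^sup>2 * (1 + q) ^ n * exp (- mu * c))"
    using cardP q0 by (intro mult_right_mono) auto
  finally show ?thesis by (simp add: q_def mult.assoc)
qed

subsection \<open>A maximal inequality for the centred walk\<close>

definition centred_sum :: "nat \<Rightarrow> nat \<Rightarrow> 'a \<Rightarrow> real" where
  "centred_sum k i \<omega> = (\<Sum>j\<in>{1..i}. X (k + j) \<omega> + a)"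

lemma centred_sum_coord_measurable:
  "{k + 1..k + i} \<subseteq> I \<Longrightarrow> centred_sum k i \<in> borel_measurable (coord_algebra I)"
  unfolding centred_sum_def
  by (intro borel_measurable_sum borel_measurable_add borel_measurable_const X_coord_measurable) auto

lemma rw_S_add: "rw_S X (k + i) \<omega> = rw_S X k \<omega> + centred_sum k i \<omega> - a * real i"
  by (induction i) (simp_all add: centred_sum_def rw_S_Suc algebra_simps)

lemma integrable_centred_square: "k \<ge> 1 \<Longrightarrow> integrable M (\<lambda>\<omega>. (X k \<omega> + a)\<^sup>2)"
  using integrable_X[of k] integrable_X_square[of k] by (simp add: power2_sum)

lemma expectation_centred_square_le: "k \<ge> 1 \<Longrightarrow> expectation (\<lambda>\<omega>. (X k \<omega> + a)\<^sup>2) \<le> second_moment"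
proof -
  assume k: "k \<ge> 1"
  have "expectation (\<lambda>\<omega>. (X k \<omega> + a)\<^sup>2) = expectation (\<lambda>\<omega>. (X k \<omega>)\<^sup>2) - a\<^sup>2"
    using integrable_X[OF k] integrable_X_square[OF k] expectation_X[OF k]
    by (simp add: power2_sum prob_space) (simp add: power2_eq_square)
  then show ?thesis
    using expectation_step[OF k, of "\<lambda>z. z\<^sup>2"] by (simp add: second_moment_def)
qed

text \<open>Kolmogorov's argument: \<open>U\<close> is the centred walk stopped at its first passage
  below - w. Its increments are orthogonal, so its second moment grows at most linearly, and after
  passage it stays below - w, to which Chebyshev's inequality applies.\<close>

lemma prob_centred_sum_ge:
  assumes w: "w > 0"
  shows "prob {\<omega> \<in> space M. \<forall>i\<in>{1..m}. centred_sum k i \<omega> \<ge> - w} \<ge> 1 - real m * second_moment / w\<^sup>2"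
proof -
  \<comment> \<open>\<open>D n\<close> looks only at indices below \<open>n\<close>, hence is
    decided before the increment \<open>Y n\<close> that it multiplies in \<open>U\<close>.\<close>
  define D where "D = (\<lambda>n \<omega>. \<forall>i\<in>{1..<n}. centred_sum k i \<omega> \<ge> - w)"
  define Y where "Y = (\<lambda>i \<omega>. X (k + i) \<omega> + a)"
  define U where "U = (\<lambda>n \<omega>. \<Sum>i\<in>{1..n}. of_bool (D i \<omega>) * Y i \<omega>)"
  define G where "G = (\<lambda>n. coord_algebra {k + 1..k + n})"
  have USuc: "U (Suc n) \<omega> = U n \<omega> + of_bool (D (Suc n) \<omega>) * Y (Suc n) \<omega>" for n \<omega>
    by (simp add: U_def del: sum_of_bool_mult_eq)
  have Dm: "Measurable.pred (G n) (D i)" if "i \<le> Suc n" for n i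
  proof -
    have [measurable]: "centred_sum k i' \<in> borel_measurable (G n)" if "i' \<in> {1..<i}" for i'
      unfolding G_def using that \<open>i \<le> Suc n\<close> by (intro centred_sum_coord_measurable) auto
    show ?thesis unfolding D_def by measurable
  qed
  have Ym: "Y i \<in> borel_measurable (coord_algebra I)" if "k + i \<in> I" for i I
    unfolding Y_def using that by (intro borel_measurable_add X_coord_measurable) auto
  have Um: "U n \<in> borel_measurable (G n)" for n
  proof -
    have [measurable]: "Measurable.pred (G n) (D i)" "Y i \<in> borel_measurable (G n)" if "i \<in> {1..n}" for i
      using that Dm[of i n] by (auto simp: G_def intro!: Ym)
    show ?thesis unfolding U_def by measurable
  qed
  have mM: "F \<in> measurable (G n) N \<Longrightarrow> F \<in> measurable M N" for F N n
    unfolding G_def by (rule coord_measurable_imp)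
  have [measurable]: "Measurable.pred M (D i)" "Y i \<in> borel_measurable M" "U n \<in> borel_measurable M" for i n
    using mM[OF Dm[of i i]] mM[OF Um[of n]] by (auto simp: Y_def)
  have Yi: "integrable M (Y i)" "expectation (Y i) = 0" if "i \<ge> 1" for i
    using integrable_X[of "k + i"] expectation_X[of "k + i"] that
    by (simp_all add: Y_def[abs_def] prob_space)
  have Y2: "integrable M (\<lambda>\<omega>. (Y i \<omega>)\<^sup>2)" "expectation (\<lambda>\<omega>. (Y i \<omega>)\<^sup>2) \<le> second_moment" if "i \<ge> 1" for i
    using integrable_centred_square[of "k + i"] expectation_centred_square_le[of "k + i"] that
    by (simp_all add: Y_def)
  have U2: "integrable M (\<lambda>\<omega>. (U n \<omega>)\<^sup>2) \<and> expectation (\<lambda>\<omega>. (U n \<omega>)\<^sup>2) \<le> real n * second_moment" for n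
  proof (induction n)
    case 0
    then show ?case by (simp add: U_def)
  next
    case (Suc n)
    let ?d = "\<lambda>\<omega>. of_bool (D (Suc n) \<omega>) :: real"
    \<comment> \<open>The mixed term has mean zero, being a function of the first \<open>n\<close>
      centred steps times an independent centred one.\<close>
    have eq: "(U (Suc n) \<omega>)\<^sup>2 = (U n \<omega>)\<^sup>2 + (2 * ((?d \<omega> * U n \<omega>) * Y (Suc n) \<omega>) + ?d \<omega> * (Y (Suc n) \<omega>)\<^sup>2)" for \<omega>
      by (cases "D (Suc n) \<omega>") (simp_all add: USuc power2_sum)
    have iU: "integrable M (U n)"
      by (rule square_integrable_imp_integrable) (use Suc.IH in auto)
    have idU: "integrable M (\<lambda>\<omega>. ?d \<omega> * U n \<omega>)"
      by (rule Bochner_Integration.integrable_bound[OF iU]) auto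
    have idY2: "integrable M (\<lambda>\<omega>. ?d \<omega> * (Y (Suc n) \<omega>)\<^sup>2)"
      by (rule Bochner_Integration.integrable_bound[OF Y2(1)[of "Suc n"]]) auto
    have dm: "(\<lambda>\<omega>. ?d \<omega> * U n \<omega>) \<in> borel_measurable (coord_algebra {k + 1..k + n})"
      using Um[of n] Dm[of "Suc n" n] unfolding G_def by measurable
    note cross = expectation_mult_coord[where I = "{k + 1..k + n}" and J = "{k + Suc n}", OF _ _ _ dm Ym idU Yi(1)]
    have c1: "expectation (\<lambda>\<omega>. (?d \<omega> * U n \<omega>) * Y (Suc n) \<omega>) = 0"
      using Yi(2)[of "Suc n"] by (subst cross(1)) auto
    have c2: "integrable M (\<lambda>\<omega>. (?d \<omega> * U n \<omega>) * Y (Suc n) \<omega>)"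
      by (rule cross(2)) auto
    have "expectation (\<lambda>\<omega>. (U (Suc n) \<omega>)\<^sup>2) = expectation (\<lambda>\<omega>. (U n \<omega>)\<^sup>2) + (2 * 0 + expectation (\<lambda>\<omega>. ?d \<omega> * (Y (Suc n) \<omega>)\<^sup>2))"
      unfolding eq c1[symmetric] using Suc.IH c2 idY2
      by (subst Bochner_Integration.integral_add, simp, simp)+ simp
    also have "expectation (\<lambda>\<omega>. ?d \<omega> * (Y (Suc n) \<omega>)\<^sup>2) \<le> expectation (\<lambda>\<omega>. (Y (Suc n) \<omega>)\<^sup>2)"
      by (intro integral_mono idY2 Y2) auto
    also have "\<dots> \<le> second_moment" by (intro Y2) auto
    finally have "expectation (\<lambda>\<omega>. (U (Suc n) \<omega>)\<^sup>2) \<le> real (Suc n) * second_moment"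
      using Suc.IH by (simp add: algebra_simps)
    moreover have "integrable M (\<lambda>\<omega>. (U (Suc n) \<omega>)\<^sup>2)"
      unfolding eq using Suc.IH c2 idY2
      by (intro Bochner_Integration.integrable_add integrable_mult_right) auto
    ultimately show ?case by simp
  qed
  have pt: "if D (Suc n) \<omega> then U n \<omega> = centred_sum k n \<omega> else U n \<omega> < - w" for n \<omega>
  proof (induction n)
    case 0
    then show ?case by (simp add: D_def U_def centred_sum_def)
  next
    case (Suc n)
    have D: "D (Suc (Suc n)) \<omega> \<longleftrightarrow> D (Suc n) \<omega> \<and> centred_sum k (Suc n) \<omega> \<ge> - w"
      by (auto simp: D_def less_Suc_eq)
    have R: "centred_sum k (Suc n) \<omega> = centred_sum k n \<omega> + Y (Suc n) \<omega>"
      by (simp add: centred_sum_def Y_def)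
    show ?case using Suc.IH D R USuc[of n \<omega>] by (auto split: if_splits)
  qed
  have "prob {\<omega> \<in> space M. \<not> D (Suc m) \<omega>} \<le> prob {\<omega> \<in> space M. (U m \<omega>)\<^sup>2 \<ge> w\<^sup>2}"
  proof (intro finite_measure_mono subsetI)
    fix \<omega> assume "\<omega> \<in> {\<omega> \<in> space M. \<not> D (Suc m) \<omega>}"
    then have "w \<le> - U m \<omega>" "\<omega> \<in> space M" using pt[of m \<omega>] by (auto split: if_splits)
    then show "\<omega> \<in> {\<omega> \<in> space M. (U m \<omega>)\<^sup>2 \<ge> w\<^sup>2}" using w power_mono[of w "- U m \<omega>" 2] by simp
  qed measurable
  also have "\<dots> \<le> expectation (\<lambda>\<omega>. (U m \<omega>)\<^sup>2) / w\<^sup>2"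
    using U2[of m] w by (intro integral_Markov_inequality_measure[where A = "space M"]) auto
  also have "\<dots> \<le> real m * second_moment / w\<^sup>2"
    using U2[of m] by (intro divide_right_mono) auto
  finally have "prob {\<omega> \<in> space M. \<not> D (Suc m) \<omega>} \<le> real m * second_moment / w\<^sup>2" .
  moreover have "prob {\<omega> \<in> space M. \<not> D (Suc m) \<omega>} = 1 - prob {\<omega> \<in> space M. D (Suc m) \<omega>}"
    by (subst prob_compl[symmetric]) (auto intro!: arg_cong[of _ _ prob])
  moreover have "{\<omega> \<in> space M. D (Suc m) \<omega>} = {\<omega> \<in> space M. \<forall>i\<in>{1..m}. centred_sum k i \<omega> \<ge> - w}"
    by (auto simp: D_def)
  ultimately show ?thesis by simp
qed

subsection \<open>One large step produces a large area\<close>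

lemma rw_A_measurable [measurable]: "rw_A X \<in> borel_measurable M"
proof -
  have [measurable]: "rw_tau X \<in> measurable M (count_space UNIV)"
    unfolding rw_tau_def by measurable
  have [measurable]: "(\<lambda>\<omega>. \<Sum>k<rw_tau X \<omega>. rw_S X k \<omega>) \<in> borel_measurable M"
    by (rule measurable_compose_countable[where f = "\<lambda>n \<omega>. \<Sum>k<n. rw_S X k \<omega>" and g = "rw_tau X"]) measurable
  show ?thesis
    unfolding rw_A_def[abs_def] by measurable
qed

text \<open>The left Riemann sum of \<open>max 0 (H - a t)\<close> dominates its integral.\<close>
lemma triangle_sum_ge:
  assumes H: "0 \<le> H"
  shows "H\<^sup>2 / (2 * a) \<le> (\<Sum>i\<le>nat \<lfloor>H / a\<rfloor>. H - a * real i)"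
proof -
  define m where "m = nat \<lfloor>H / a\<rfloor>"
  define f where "f = real m + 1 - H / a"
  have "0 \<le> H / a" using H a_pos by simp
  then have m: "real m \<le> H / a" "H / a < real m + 1" unfolding m_def by linarith+
  then have f: "0 \<le> f" "f \<le> 1" by (auto simp: f_def)
  have sum: "(\<Sum>i\<le>n. H - a * real i) = (real n + 1) * (H - a * real n / 2)" for n
    by (induction n) (simp_all add: field_simps)
  have "H = a * (real m + 1 - f)" using a_pos by (simp add: f_def)
  then have *: "H + a * f = a * (real m + 1)" "H - a * real m / 2 = (H + a * (1 - f)) / 2"
    by (simp_all add: algebra_simps)
  have "(real m + 1) * (H - a * real m / 2) = (H + a * f) * (H + a * (1 - f)) / (2 * a)"
    unfolding * using a_pos by simp
  moreover have "H * H \<le> (H + a * f) * (H + a * (1 - f))"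
    using H f a_pos by (intro mult_mono) auto
  ultimately show ?thesis
    using a_pos unfolding m_def[symmetric] sum by (simp add: divide_right_mono power2_eq_square)
qed

text \<open>After the jump the walk is above y + 2 w. One \<open>w\<close> is reserved for
  fluctuations, so the walk stays above the line from y + w with slope - a until that line reaches
  zero; the other makes the triangle area strictly larger than y^2 / (2 a).\<close>

lemma area_gt_of_jump:
  assumes hit: "\<exists>n\<ge>1. rw_S X n \<omega> \<le> 0" and k: "k \<ge> 1" and alive: "alive k \<omega>"
    and jump: "X k \<omega> > y + 2 * w" and y: "0 < y" and w: "0 < w"
    and after: "\<forall>i\<in>{1..nat \<lfloor>(y + w) / a\<rfloor>}. centred_sum k i \<omega> \<ge> - w"
  shows "rw_A X \<omega> > y\<^sup>2 / (2 * a)"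
proof -
  define m where "m = nat \<lfloor>(y + w) / a\<rfloor>"
  have m: "real m \<le> (y + w) / a" unfolding m_def using y w a_pos by simp
  obtain k' where k': "k = Suc k'" using k by (cases k) auto
  have pre: "rw_S X i \<omega> \<ge> 0" if "i < k" for i
    using alive that by (cases i) (auto simp: alive_def intro: less_imp_le)
  then have Sk: "rw_S X k \<omega> > y + 2 * w"
    using jump by (simp add: k' rw_S_Suc) (smt (verit) lessI)
  have post: "rw_S X (k + i) \<omega> > y + w - a * real i" if "i \<le> m" for i
  proof -
    have "centred_sum k i \<omega> \<ge> - w"
      using after that w by (cases "i = 0") (auto simp: m_def centred_sum_def[of k 0])
    then show ?thesis using Sk by (simp add: rw_S_add)
  qed
  have post0: "rw_S X (k + i) \<omega> > 0" if "i \<le> m" for i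
  proof -
    have "a * real i \<le> a * ((y + w) / a)" using that m a_pos by (intro mult_left_mono) auto
    then show ?thesis using post[OF that] a_pos by simp
  qed
  have "alive (k + m + 1) \<omega>"
    unfolding alive_def
  proof
    fix i assume i: "i \<in> {1..<k + m + 1}"
    show "rw_S X i \<omega> > 0"
    proof (cases "i < k")
      case True
      then show ?thesis using alive i by (auto simp: alive_def)
    next
      case False
      then have "i - k \<le> m" "k + (i - k) = i" using i by auto
      then show ?thesis using post0[of "i - k"] by simp
    qed
  qed
  \<comment> \<open>All indices from \<open>k\<close> to k + m thus lie below \<tau> and are counted
    by the area, which stops at \<tau> - 1.\<close>
  then have tau: "k + m + 1 \<le> rw_tau X \<omega>" using alive_iff_le_tau[OF hit] by simp
  have pos: "rw_S X i \<omega> \<ge> 0" if "i < rw_tau X \<omega>" for i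
  proof (cases "i = 0")
    case False
    have "alive (rw_tau X \<omega>) \<omega>" using alive_iff_le_tau[OF hit] by simp
    then show ?thesis using that False by (auto simp: alive_def intro: less_imp_le)
  qed simp
  have "y\<^sup>2 / (2 * a) < (y + w)\<^sup>2 / (2 * a)"
    using y w a_pos by (intro divide_strict_right_mono power_strict_mono) auto
  also have "\<dots> \<le> (\<Sum>i\<le>m. y + w - a * real i)"
    unfolding m_def using y w by (intro triangle_sum_ge) simp
  also have "\<dots> \<le> (\<Sum>i\<le>m. rw_S X (k + i) \<omega>)"
    by (intro sum_mono order.strict_implies_order[OF post]) auto
  also have "\<dots> = (\<Sum>i\<in>(\<lambda>i. k + i) ` {..m}. rw_S X i \<omega>)"
    by (simp add: sum.reindex inj_on_def del: image_add_atMost)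
  also have "\<dots> \<le> (\<Sum>i<rw_tau X \<omega>. rw_S X i \<omega>)"
    using tau pos by (intro sum_mono2) auto
  finally show ?thesis using hit by (simp add: rw_A_def)
qed

text \<open>The event \<open>E k\<close> says that time \<open>k\<close> is reached, that step
  \<open>k\<close> is the first one above \<open>h\<close>, and that the walk does not dip
  afterwards. These events are disjoint in \<open>k\<close>, and the blocks before, at and after
  \<open>k\<close> are independent. Excluding earlier large steps costs at most N times the tail at
  \<open>h\<close>.\<close>

lemma prob_area_ge:
  assumes y: "0 < y" and w: "0 < w"
    and rho: "real (nat \<lfloor>(y + w) / a\<rfloor>) * second_moment / w\<^sup>2 \<le> \<rho>" "\<rho> \<le> 1"
  shows "Fbar M X (y + 2 * w) * (1 - \<rho>) * (\<Sum>k\<in>{1..N}. alive_prob k - real N * Fbar M X (y + 2 * w))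
    \<le> prob {\<omega> \<in> space M. rw_A X \<omega> > y\<^sup>2 / (2 * a)}"
proof -
  define h where "h = y + 2 * w"
  define m where "m = nat \<lfloor>(y + w) / a\<rfloor>"
  define B where "B = (\<lambda>k \<omega>. alive k \<omega> \<and> (\<forall>j\<in>{1..<k}. X j \<omega> \<le> h))"
  define C where "C = (\<lambda>k \<omega>. \<forall>i\<in>{1..m}. centred_sum k i \<omega> \<ge> - w)"
  define E where "E = (\<lambda>k. {\<omega> \<in> space M. B k \<omega> \<and> (X k \<omega> > h \<and> C k \<omega>)})"
  have Bm: "Measurable.pred (coord_algebra {1..<k}) (B k)" for k
  proof -
    have [measurable]: "X j \<in> borel_measurable (coord_algebra {1..<k})" if "j \<in> {1..<k}" for j
      by (rule X_coord_measurable[OF that])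
    note [measurable] = alive_coord_measurable[of k]
    show ?thesis unfolding B_def by measurable
  qed
  have Cm: "Measurable.pred (coord_algebra I) (C k)" if "{k + 1..k + m} \<subseteq> I" for k I
  proof -
    have [measurable]: "centred_sum k i \<in> borel_measurable (coord_algebra I)" if "i \<in> {1..m}" for i
      using that \<open>{k + 1..k + m} \<subseteq> I\<close> by (intro centred_sum_coord_measurable) auto
    show ?thesis unfolding C_def by measurable
  qed
  have Xm: "Measurable.pred (coord_algebra I) (\<lambda>\<omega>. X k \<omega> > h)" if "k \<in> I" for k I
  proof -
    note [measurable] = X_coord_measurable[OF that]
    show ?thesis by measurable
  qed
  have XCm: "Measurable.pred (coord_algebra I) (\<lambda>\<omega>. X k \<omega> > h \<and> C k \<omega>)" if "{k..k + m} \<subseteq> I" for k I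
  proof -
    have [measurable]: "Measurable.pred (coord_algebra I) (\<lambda>\<omega>. X k \<omega> > h)" "Measurable.pred (coord_algebra I) (C k)"
      using that by (auto intro!: Xm Cm)
    show ?thesis by measurable
  qed
  have [measurable]: "Measurable.pred M (B k)" "Measurable.pred M (\<lambda>\<omega>. X k \<omega> > h \<and> C k \<omega>)" for k
    using coord_measurable_imp[OF Bm] coord_measurable_imp[OF XCm] by auto
  have Em [measurable]: "E k \<in> events" for k unfolding E_def by measurable
  have PB: "alive_prob k - real N * Fbar M X h \<le> prob {\<omega> \<in> space M. B k \<omega>}" if "k \<in> {1..N}" for k
  proof -
    have "alive_prob k \<le> prob ({\<omega> \<in> space M. B k \<omega>} \<union> (\<Union>j\<in>{1..<k}. {\<omega> \<in> space M. X j \<omega> > h}))"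
      unfolding alive_prob_def by (intro finite_measure_mono) (auto simp: B_def not_le)
    also have "\<dots> \<le> prob {\<omega> \<in> space M. B k \<omega>} + prob (\<Union>j\<in>{1..<k}. {\<omega> \<in> space M. X j \<omega> > h})"
      by (intro measure_Un_le) measurable
    also have "prob (\<Union>j\<in>{1..<k}. {\<omega> \<in> space M. X j \<omega> > h}) \<le> (\<Sum>j\<in>{1..<k}. prob {\<omega> \<in> space M. X j \<omega> > h})"
      by (intro finite_measure_subadditive_finite) auto
    also have "\<dots> = real (k - 1) * Fbar M X h"
      by (simp add: prob_step_gt)
    also have "\<dots> \<le> real N * Fbar M X h"
      using that Fbar_nonneg by (intro mult_right_mono) auto
    finally show ?thesis by simp
  qed
  have PE: "Fbar M X h * (1 - \<rho>) * (alive_prob k - real N * Fbar M X h) \<le> prob (E k)" if k: "k \<in> {1..N}" for k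
  proof -
    have "1 - \<rho> \<le> prob {\<omega> \<in> space M. C k \<omega>}"
      using prob_centred_sum_ge[OF w, of m k] rho(1) unfolding C_def m_def by linarith
    then have "Fbar M X h * (1 - \<rho>) \<le> Fbar M X h * prob {\<omega> \<in> space M. C k \<omega>}"
      by (intro mult_left_mono Fbar_nonneg)
    also have "\<dots> = prob {\<omega> \<in> space M. X k \<omega> > h \<and> C k \<omega>}"
      using k prob_step_gt[of k h]
      by (subst prob_conj_coord[where I = "{k}" and J = "{k + 1..k + m}"]) (auto intro!: Xm Cm)
    finally have XC: "Fbar M X h * (1 - \<rho>) \<le> prob {\<omega> \<in> space M. X k \<omega> > h \<and> C k \<omega>}" .
    have "Fbar M X h * (1 - \<rho>) * (alive_prob k - real N * Fbar M X h) \<le> Fbar M X h * (1 - \<rho>) * prob {\<omega> \<in> space M. B k \<omega>}"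
      using PB[OF k] rho(2) Fbar_nonneg by (intro mult_left_mono) auto
    also have "\<dots> \<le> prob {\<omega> \<in> space M. X k \<omega> > h \<and> C k \<omega>} * prob {\<omega> \<in> space M. B k \<omega>}"
      by (intro mult_right_mono XC) auto
    also have "\<dots> = prob (E k)"
    proof -
      have "prob (E k) = prob {\<omega> \<in> space M. B k \<omega>} * prob {\<omega> \<in> space M. X k \<omega> > h \<and> C k \<omega>}"
        unfolding E_def using k by (intro prob_conj_coord[OF _ _ _ Bm XCm[OF order_refl]]) auto
      then show ?thesis by simp
    qed
    finally show ?thesis .
  qed
  have disj: "disjoint_family_on E {1..N}"
    unfolding disjoint_family_on_def
  proof (intro ballI impI)
    have "E k \<inter> E k' = {}" if "k < k'" "k \<in> {1..N}" for k k'
    proof -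
      have "k \<in> {1..<k'}" using that by auto
      then have "\<omega> \<notin> E k'" if "\<omega> \<in> E k" for \<omega>
        using that by (auto simp: E_def B_def not_le[symmetric])
      then show ?thesis by blast
    qed
    then show "E k \<inter> E k' = {}" if "k \<in> {1..N}" "k' \<in> {1..N}" "k \<noteq> k'" for k k'
      using that by (metis Int_commute linorder_neqE_nat)
  qed
  have "Fbar M X h * (1 - \<rho>) * (\<Sum>k\<in>{1..N}. alive_prob k - real N * Fbar M X h) \<le> (\<Sum>k\<in>{1..N}. prob (E k))"
    unfolding sum_distrib_left by (intro sum_mono PE)
  also have "\<dots> = prob (\<Union>k\<in>{1..N}. E k)"
    by (intro finite_measure_finite_Union[symmetric] disj) auto
  also have "\<dots> \<le> prob {\<omega> \<in> space M. rw_A X \<omega> > y\<^sup>2 / (2 * a)}"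
  \<comment> \<open>The inclusion holds only almost everywhere: \<open>rw_A\<close> is set to zero
    on paths that never hit.\<close>
  proof (rule finite_measure_mono_AE)
    show "AE \<omega> in M. \<omega> \<in> (\<Union>k\<in>{1..N}. E k) \<longrightarrow> \<omega> \<in> {\<omega> \<in> space M. rw_A X \<omega> > y\<^sup>2 / (2 * a)}"
      using AE_hit
    proof eventually_elim
      case (elim \<omega>)
      show ?case
      proof
        assume "\<omega> \<in> (\<Union>k\<in>{1..N}. E k)"
        then obtain k where "k \<ge> 1" "alive k \<omega>" "X k \<omega> > h" "C k \<omega>" "\<omega> \<in> space M"
          by (auto simp: E_def B_def)
        with area_gt_of_jump[OF elim, of k y w] y w
        show "\<omega> \<in> {\<omega> \<in> space M. rw_A X \<omega> > y\<^sup>2 / (2 * a)}"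
          by (auto simp: h_def C_def m_def)
      qed
    qed
  qed measurable
  finally show ?thesis by (simp add: h_def)
qed

end

section \<open>Elementary bounds for tilted tail sums\<close>

text \<open>Below 2 the exponential is at most 9; above 2 the function exp v / v^2 increases, so its
  value at u L is at most that at \<open>L\<close>. With u = t / b the factor u^2 cancels the t^2 in
  the denominator of the tail.\<close>

lemma exp_mult_le_quadratic:
  fixes u L :: real
  assumes "0 \<le> u" "u \<le> 1" "0 \<le> L"
  shows "exp (u * L) \<le> 9 + u\<^sup>2 * exp L"
proof (cases "u * L \<le> 2")
  case True
  then have "exp (u * L) \<le> exp (1 + 1)" by simp
  also have "\<dots> = exp 1 * exp (1::real)" by (rule exp_add)
  also have "\<dots> \<le> 3 * 3" using exp_le by (intro mult_mono) auto
  finally show ?thesis by (simp add: add_increasing2)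
next
  case False
  define v where "v = u * L"
  have v: "2 < v" "v \<le> L" using False assms by (auto simp: v_def mult_left_le_one_le)
  have u: "u = v / L" using v by (simp add: v_def)
  have "L / v = 1 + (L - v) / v" using v by (simp add: field_simps)
  also have "(L - v) / v \<le> (L - v) / 2" using v by (intro divide_left_mono) auto
  also have "1 + (L - v) / 2 \<le> exp ((L - v) / 2)" by (rule exp_ge_add_one_self)
  finally have "(L / v)\<^sup>2 \<le> (exp ((L - v) / 2))\<^sup>2" using v by (intro power_mono) auto
  also have "\<dots> = exp (L - v)" by (simp flip: exp_double)
  finally have "exp v * (L / v)\<^sup>2 \<le> exp v * exp (L - v)" by (intro mult_left_mono) auto
  also have "\<dots> = exp L" by (simp flip: exp_add)
  finally have "exp v \<le> u\<^sup>2 * exp L"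
    unfolding u using v by (simp add: power_divide field_simps)
  then show ?thesis by (simp add: v_def add_increasing)
qed

lemma sum_inverse_squares_le: "(\<Sum>i<N. 1 / (real i + 1)\<^sup>2) \<le> 2 - 1 / real N"
proof (induction N)
  case (Suc N)
  show ?case
  proof (cases "N = 0")
    case False
    have "(real N + 1) * real N \<le> (real N + 1)\<^sup>2" by (simp add: power2_eq_square)
    then have "1 / (real N + 1)\<^sup>2 \<le> 1 / ((real N + 1) * real N)"
      using False by (intro divide_left_mono) auto
    also have "\<dots> = 1 / real N - 1 / (real N + 1)"
      using False by (simp add: field_simps)
    finally show ?thesis using Suc by (simp add: add.commute)
  qed simp
qed simp

section \<open>Consequences of the tail and growth assumptions\<close>

locale subexponential_walk = negative_drift_walk M X a for M :: "'a measure" and X a +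
  fixes g :: "real \<Rightarrow> real"
  assumes tail: "(\<lambda>x. Fbar M X x) \<sim>[at_top] (\<lambda>x. exp (- g x) / x\<^sup>2)"
    and g_ratio: "\<And>x y. 0 < x \<Longrightarrow> x \<le> y \<Longrightarrow> g y / y \<le> g x / x"
    and g_ratio_tendsto: "((\<lambda>x. g x / x) \<longlongrightarrow> 0) at_top"
begin

lemma g_nonneg: "0 < x \<Longrightarrow> 0 \<le> g x"
proof -
  assume x: "0 < x"
  have "0 \<le> g x / x"
  proof (rule tendsto_upperbound[OF g_ratio_tendsto])
    show "\<forall>\<^sub>F y in at_top. g y / y \<le> g x / x"
      using eventually_ge_at_top[of x] by eventually_elim (use x g_ratio in auto)
  qed simp
  then show ?thesis using x by (simp add: zero_le_divide_iff)
qed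

text \<open>The function lies above its chord from the origin to (y, g y), which lets a tilt of size
  g y / y be absorbed by the tail at every t \<le> y.\<close>

lemma g_mult_le: "0 < t \<Longrightarrow> t \<le> y \<Longrightarrow> g y * (t / y) \<le> g t"
  using g_ratio[of t y] by (simp add: field_simps)

lemma Fbar_bounds:
  "\<forall>\<^sub>F t in at_top. exp (- g t) / t\<^sup>2 / 2 \<le> Fbar M X t \<and> Fbar M X t \<le> 2 * (exp (- g t) / t\<^sup>2)"
proof -
  \<comment> \<open>\<open>asymp_equiv_def\<close> sets the quotient to 1 when both sides vanish;
    positivity of the comparison function later removes that case.\<close>
  have "((\<lambda>x. if Fbar M X x = 0 \<and> exp (- g x) / x\<^sup>2 = 0 then 1 else Fbar M X x / (exp (- g x) / x\<^sup>2)) \<longlongrightarrow> 1) at_top"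
    using tail by (simp add: asymp_equiv_def)
  from order_tendstoD(1)[OF this, of "1/2"] order_tendstoD(2)[OF this, of 2]
  have "\<forall>\<^sub>F x in at_top. 1 / 2 < (if Fbar M X x = 0 \<and> exp (- g x) / x\<^sup>2 = 0 then 1 else Fbar M X x / (exp (- g x) / x\<^sup>2))"
    "\<forall>\<^sub>F x in at_top. (if Fbar M X x = 0 \<and> exp (- g x) / x\<^sup>2 = 0 then 1 else Fbar M X x / (exp (- g x) / x\<^sup>2)) < 2"
    by simp_all
  then show ?thesis
    using eventually_gt_at_top[of 0]
  proof eventually_elim
    case (elim t)
    have pos: "0 < exp (- g t) / t\<^sup>2" using elim by simp
    then have "1 / 2 < Fbar M X t / (exp (- g t) / t\<^sup>2)" "Fbar M X t / (exp (- g t) / t\<^sup>2) < 2"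
      using elim by (auto split: if_splits)
    then show ?case
      unfolding pos_less_divide_eq[OF pos] pos_divide_less_eq[OF pos] by simp
  qed
qed

lemma Fbar_tendsto_0: "((\<lambda>t. Fbar M X t) \<longlongrightarrow> 0) at_top"
proof (rule tendsto_sandwich[OF _ _ tendsto_const])
  show "\<forall>\<^sub>F t in at_top. 0 \<le> Fbar M X t" using Fbar_nonneg by simp
  show "\<forall>\<^sub>F t in at_top. Fbar M X t \<le> 2 / t\<^sup>2"
    using Fbar_bounds eventually_gt_at_top[of 0]
  proof eventually_elim
    case (elim t)
    have "exp (- g t) / t\<^sup>2 \<le> 1 / t\<^sup>2"
      using g_nonneg[of t] elim by (intro divide_right_mono) auto
    then show ?case using elim by simp
  qed
  show "((\<lambda>t::real. 2 / t\<^sup>2) \<longlongrightarrow> 0) at_top" by real_asymp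
qed

text \<open>By \<open>cond\<close> a grid term is at most 2 exp ((t / b) (ln b / 2)) / t^2, and
  \<open>exp_mult_le_quadratic\<close> splits this into 18 / t^2 plus 2 sqrt b / b^2. The first part
  sums to order l^2 because t = (i + 1) / l; the second, over at most l b terms, to order l / sqrt
  b.\<close>

lemma mgf_error_le:
  assumes tail_le: "\<And>t. t \<ge> t0 \<Longrightarrow> Fbar M X t \<le> 2 * (exp (- g t) / t\<^sup>2)"
    and l: "0 < l" "t0 \<le> 1 / l" and b: "1 \<le> b"
    and cond: "\<And>t. 1 / l \<le> t \<Longrightarrow> t \<le> b \<Longrightarrow> l * t \<le> g t + t / b * (ln b / 2)"
  shows "mgf_error l b \<le> (second_moment + 36 * exp 1) * (l\<^sup>2 + l / sqrt b)"
proof -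
  define N where "N = nat \<lceil>l * b - 1\<rceil>"
  let ?t = "\<lambda>i. 1 / l + real i / l"
  have lb: "0 < l * b" using l b by simp
  have N: "real N \<le> l * b" "l * b - 1 \<le> real N" using lb unfolding N_def by linarith+
  have summand: "exp (l * ?t i) * Fbar M X (?t i) \<le> 18 * l\<^sup>2 * (1 / (real i + 1)\<^sup>2) + 2 * sqrt b / b\<^sup>2" if i: "i < N" for i
  proof -
    define t where "t = ?t i"
    have t: "t = (real i + 1) / l" by (simp add: t_def add_divide_distrib)
    have "real i < l * b - 1" using i unfolding N_def by linarith
    then have tb: "t < b" using l by (simp add: t field_simps)
    have t1: "1 / l \<le> t" using l by (simp add: t_def)
    have t0: "0 < t" using l by (simp add: t)
    have "exp (l * t) * Fbar M X t \<le> exp (l * t) * (2 * (exp (- g t) / t\<^sup>2))"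
      using t1 l by (intro mult_left_mono tail_le) auto
    also have "\<dots> = 2 * exp (l * t - g t) / t\<^sup>2"
      by (simp add: exp_diff exp_minus field_simps)
    also have "\<dots> \<le> 2 * exp (t / b * (ln b / 2)) / t\<^sup>2"
      using cond[OF t1] tb by (intro divide_right_mono mult_left_mono) auto
    also have "\<dots> \<le> 2 * (9 + (t / b)\<^sup>2 * exp (ln b / 2)) / t\<^sup>2"
      using t0 tb b by (intro divide_right_mono mult_left_mono exp_mult_le_quadratic) auto
    also have "exp (ln b / 2) = sqrt b"
      using b by (simp add: powr_half_sqrt[symmetric] powr_def)
    also have "2 * (9 + (t / b)\<^sup>2 * sqrt b) / t\<^sup>2 = 18 * (1 / t\<^sup>2) + 2 * sqrt b / b\<^sup>2"
      using t0 b by (simp add: field_simps)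
    also have "1 / t\<^sup>2 = l\<^sup>2 * (1 / (real i + 1)\<^sup>2)"
      by (simp add: t power_divide)
    finally show ?thesis by (simp add: t_def)
  qed
  have "exp_tail l (1 / l) b \<le> exp 1 * (\<Sum>i<N. exp (l * ?t i) * Fbar M X (?t i))"
    using l N by (intro exp_tail_le_sum) (auto simp: field_simps)
  also have "\<dots> \<le> exp 1 * (\<Sum>i<N. 18 * l\<^sup>2 * (1 / (real i + 1)\<^sup>2) + 2 * sqrt b / b\<^sup>2)"
    by (intro mult_left_mono sum_mono summand) auto
  also have "(\<Sum>i<N. 18 * l\<^sup>2 * (1 / (real i + 1)\<^sup>2) + 2 * sqrt b / b\<^sup>2)
      = 18 * l\<^sup>2 * (\<Sum>i<N. 1 / (real i + 1)\<^sup>2) + real N * (2 * sqrt b / b\<^sup>2)"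
    by (simp add: sum.distrib sum_distrib_left)
  also have "\<dots> \<le> 18 * l\<^sup>2 * 2 + (l * b) * (2 * sqrt b / b\<^sup>2)"
  proof -
    have "0 \<le> 1 / real N" by simp
    then have "(\<Sum>i<N. 1 / (real i + 1)\<^sup>2) \<le> 2" using sum_inverse_squares_le[of N] by linarith
    then show ?thesis using b N by (intro add_mono mult_left_mono mult_right_mono) auto
  qed
  also have "(l * b) * (2 * sqrt b / b\<^sup>2) = 2 * (l / sqrt b)"
  proof -
    have "b = sqrt b * sqrt b" using b by simp
    then have "(l * b) * (2 * sqrt b / b\<^sup>2) = l * (2 * sqrt b) / (sqrt b * sqrt b)"
      using b by (simp add: power2_eq_square)
    then show ?thesis using b by (simp add: field_simps)
  qed
  finally have "exp_tail l (1 / l) b \<le> exp 1 * (36 * l\<^sup>2 + 2 * (l / sqrt b))" by simp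
  also have "\<dots> \<le> exp 1 * (36 * (l\<^sup>2 + l / sqrt b))"
  proof (rule mult_left_mono)
    have "36 * L + 2 * r \<le> 36 * (L + r)" if "0 \<le> r" for L r :: real
      using that by simp
    then show "36 * l\<^sup>2 + 2 * (l / sqrt b) \<le> 36 * (l\<^sup>2 + l / sqrt b)"
      using l b by (metis divide_nonneg_nonneg less_imp_le order.trans real_sqrt_ge_zero zero_le_one)
  qed simp
  also have "\<dots> = 36 * exp 1 * (l\<^sup>2 + l / sqrt b)" by (simp only: mult.assoc mult.left_commute)
  finally have "mgf_error l b \<le> l\<^sup>2 * second_moment + 36 * exp 1 * (l\<^sup>2 + l / sqrt b)"
    by (simp only: mgf_error_def add_left_mono)
  also have "l\<^sup>2 * second_moment \<le> second_moment * (l\<^sup>2 + l / sqrt b)"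
    using second_moment_nonneg l b by (simp add: algebra_simps)
  finally show ?thesis by (simp only: distrib_right)
qed

text \<open>\<open>g_mult_le\<close> absorbs g y (t / y) and the extra 1 in the tilt costs only a
  factor e, so each cell contributes at most a multiple of 1 / b^2. There are at most g y + 2 cells.
  The extra 1 also keeps the tilt positive when g y = 0.\<close>

lemma exp_tail_le:
  assumes tail_le: "\<And>t. t \<ge> t0 \<Longrightarrow> Fbar M X t \<le> 2 * (exp (- g t) / t\<^sup>2)"
    and b: "t0 \<le> b" "0 < b" "b \<le> c" "c \<le> y"
  shows "exp_tail ((g y + 1) / y) b c \<le> 2 * (exp 1)\<^sup>2 * (g y + 2) / b\<^sup>2"
proof -
  define mu where "mu = (g y + 1) / y"
  define N where "N = nat \<lceil>mu * (c - b)\<rceil>"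
  have y: "0 < y" using b by simp
  have g0: "0 \<le> g y" using g_nonneg[OF y] .
  have mu: "0 < mu" using y g0 by (simp add: mu_def)
  have "0 \<le> mu * (c - b)" using mu b by simp
  then have N: "real N \<le> mu * (c - b) + 1" "mu * (c - b) \<le> real N" unfolding N_def by linarith+
  have "mu * (c - b) \<le> mu * y" using mu b by (intro mult_left_mono) auto
  then have N2: "real N \<le> g y + 2" using N y by (simp add: mu_def)
  have summand: "exp (mu * (b + real i / mu)) * Fbar M X (b + real i / mu) \<le> 2 * exp 1 / b\<^sup>2" if i: "i < N" for i
  proof -
    define t where "t = b + real i / mu"
    have "real i < mu * (c - b)" using i unfolding N_def by linarith
    then have tc: "t < c" using mu by (simp add: t_def field_simps)
    have tb: "b \<le> t" using mu by (simp add: t_def)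
    have "mu * t = g y * (t / y) + t / y" by (simp add: mu_def distrib_right add_divide_distrib)
    also have "\<dots> \<le> g t + 1" using g_mult_le[of t y] tc tb b by (intro add_mono) auto
    finally have mt: "mu * t - g t \<le> 1" by simp
    have "exp (mu * t) * Fbar M X t \<le> exp (mu * t) * (2 * (exp (- g t) / t\<^sup>2))"
      using tb b by (intro mult_left_mono tail_le) auto
    also have "\<dots> = 2 * exp (mu * t - g t) / t\<^sup>2"
      by (simp add: exp_diff exp_minus field_simps)
    also have "\<dots> \<le> 2 * exp 1 / t\<^sup>2"
      using mt by (intro divide_right_mono mult_left_mono) auto
    also have "\<dots> \<le> 2 * exp 1 / b\<^sup>2"
      using tb b by (intro divide_left_mono power_mono mult_pos_pos zero_less_power) auto
    finally show ?thesis by (simp add: t_def)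
  qed
  have "exp_tail mu b c \<le> exp 1 * (\<Sum>i<N. exp (mu * (b + real i / mu)) * Fbar M X (b + real i / mu))"
    using mu N by (intro exp_tail_le_sum) (auto simp: field_simps)
  also have "\<dots> \<le> exp 1 * (\<Sum>i<N. 2 * exp 1 / b\<^sup>2)"
    by (intro mult_left_mono sum_mono summand) auto
  also have "\<dots> = real N * (2 * (exp 1)\<^sup>2 / b\<^sup>2)"
    by (simp add: power2_eq_square)
  also have "\<dots> \<le> (g y + 2) * (2 * (exp 1)\<^sup>2 / b\<^sup>2)"
    by (intro mult_right_mono N2) auto
  finally show ?thesis by (simp add: mu_def mult.commute)
qed

lemma eventually_length_bounds:
  "\<forall>\<^sub>F y in at_top. real (nat \<lceil>2 * y / a\<rceil>) \<le> (2 / a + 1) * y \<and> 2 * y / a \<le> real (nat \<lceil>2 * y / a\<rceil>)"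
  using eventually_ge_at_top[of 1]
proof eventually_elim
  case (elim y)
  have "0 \<le> 2 * y / a" using elim a_pos by simp
  then have "real (nat \<lceil>2 * y / a\<rceil>) \<le> 2 * y / a + 1" "2 * y / a \<le> real (nat \<lceil>2 * y / a\<rceil>)"
    by linarith+
  moreover have "2 * y / a + 1 \<le> (2 / a + 1) * y" using elim by (simp add: algebra_simps)
  ultimately show ?case by linarith
qed

lemma tail_bound: "\<exists>t0>0. \<forall>t\<ge>t0. Fbar M X t \<le> 2 * (exp (- g t) / t\<^sup>2)"
proof -
  obtain T where "\<forall>t\<ge>T. Fbar M X t \<le> 2 * (exp (- g t) / t\<^sup>2)"
    using Fbar_bounds unfolding eventually_at_top_linorder by blast
  then have "\<forall>t\<ge>max T 1. Fbar M X t \<le> 2 * (exp (- g t) / t\<^sup>2)" by simp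
  moreover have "max T 1 > 0" by simp
  ultimately show ?thesis by blast
qed

text \<open>The tilts \<open>l\<close> below have this form; since they vanish, 1 / l eventually
  passes the threshold beyond which the tail bound holds.\<close>

lemma rate_tendsto_0: "((\<lambda>y. c * (g y + d * ln y) / y) \<longlongrightarrow> 0) at_top"
proof -
  have "((\<lambda>y. c * (g y / y) + c * d * (ln y / y)) \<longlongrightarrow> c * 0 + c * d * 0) at_top"
  proof (intro tendsto_add tendsto_mult tendsto_const g_ratio_tendsto)
    show "((\<lambda>y::real. ln y / y) \<longlongrightarrow> 0) at_top" by real_asymp
  qed
  then show ?thesis by (simp add: add_divide_distrib distrib_left mult.assoc)
qed

subsection \<open>The upper bounds\<close>

text \<open>Here b = c = y and v = 0, so the clipped sum is zero. The tilt gives exp (- l y) = exp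
  (- g y) / sqrt y against about K y lengths, which leaves sqrt y. The accumulated error is of order
  l^2 y + l sqrt y, that is a constant plus a multiple of (g y)^2 / y.\<close>

lemma eventually_prob_area_le:
  "\<exists>C>0. \<forall>\<^sub>F y in at_top. prob {\<omega> \<in> space M. rw_A X \<omega> > y\<^sup>2 / (2 * a)}
    \<le> C * sqrt y * exp (- g y + C * (g y)\<^sup>2 / y)"
proof -
  obtain t0 where t0: "t0 > 0" and tail_le: "\<And>t. t \<ge> t0 \<Longrightarrow> Fbar M X t \<le> 2 * (exp (- g t) / t\<^sup>2)"
    using tail_bound by blast
  define K where "K = 2 / a + 1"
  define D where "D = second_moment + 36 * exp 1"
  \<comment> \<open>The first two summands collect the prefactors of the single jump and of the
    Chernoff term; the last one dominates the coefficient of (g y)^2 / y in the exponent.\<close>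
  define C where "C = 2 * mean_length + (K + 1) * exp (a / 2 + 3 * (K * D)) + 4 * (K * D)"
  have K: "K > 0" using a_pos by (simp add: K_def add_pos_pos)
  have D: "D > 0" using second_moment_nonneg by (simp add: D_def add_nonneg_pos)
  have KD: "0 < K * D" using K D by simp
  have "0 < (K + 1) * exp (a / 2 + 3 * (K * D))" using K by simp
  then have Cge: "2 * mean_length + (K + 1) * exp (a / 2 + 3 * (K * D)) \<le> C" "4 * (K * D) \<le> C" and C: "C > 0"
    using KD mean_length_nonneg unfolding C_def by linarith+
  define l where "l = (\<lambda>y. 1 * (g y + 1 / 2 * ln y) / y)"
  have l_lim: "(l \<longlongrightarrow> 0) at_top" unfolding l_def by (rule rate_tendsto_0)
  have ev: "\<forall>\<^sub>F y in at_top. l y < min 1 (1 / t0)"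
    using l_lim t0 by (intro order_tendstoD) auto
  have ln2: "\<forall>\<^sub>F y::real in at_top. (ln y)\<^sup>2 / (2 * y) \<le> 1" by real_asymp
  have "\<forall>\<^sub>F y in at_top. prob {\<omega> \<in> space M. rw_A X \<omega> > y\<^sup>2 / (2 * a)}
    \<le> C * sqrt y * exp (- g y + C * (g y)\<^sup>2 / y)"
    using ev ln2 eventually_length_bounds eventually_gt_at_top[of 1] eventually_ge_at_top[of t0]
  proof eventually_elim
    case (elim y)
    define n0 where "n0 = nat \<lceil>2 * y / a\<rceil>"
    have y: "1 < y" "t0 \<le> y" and n0: "real n0 \<le> K * y" "2 * y / a \<le> real n0"
      and ly1: "l y \<le> 1" and lyt: "l y < 1 / t0" and lny: "(ln y)\<^sup>2 / (2 * y) \<le> 1"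
      using elim by (auto simp: n0_def K_def)
    have g0: "0 \<le> g y" using g_nonneg y by simp
    have lpos: "0 < l y" unfolding l_def using g0 y by (simp add: add_nonneg_pos)
    have lt: "t0 \<le> 1 / l y" using lyt lpos t0 by (simp add: field_simps)
    have lyy: "l y * y = g y + ln y / 2" using y by (simp add: l_def)
    have mgf: "mgf_error (l y) y \<le> D * ((l y)\<^sup>2 + l y / sqrt y)"
      unfolding D_def
    proof (rule mgf_error_le[OF tail_le lpos lt])
      fix t assume t: "1 / l y \<le> t" "t \<le> y"
      have tpos: "0 < t" using t lpos by (meson less_le_trans zero_less_divide_1_iff)
      have "l y * t = g y * (t / y) + t / y * (ln y / 2)"
        by (simp add: l_def add_divide_distrib distrib_right) (simp add: mult.commute)
      then show "l y * t \<le> g t + t / y * (ln y / 2)"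
        using g_mult_le[OF tpos t(2)] by simp
    qed (use y in auto)
    have l2y: "(l y)\<^sup>2 * y \<le> 2 * (g y)\<^sup>2 / y + 1"
    proof -
      have "(l y)\<^sup>2 * y = (g y + ln y / 2)\<^sup>2 / y"
        unfolding lyy[symmetric] using y by (simp add: power2_eq_square)
      also have "\<dots> \<le> (2 * (g y)\<^sup>2 + (ln y)\<^sup>2 / 2) / y"
      proof (rule divide_right_mono)
        have "0 \<le> (g y - ln y / 2)\<^sup>2" by simp
        then show "(g y + ln y / 2)\<^sup>2 \<le> 2 * (g y)\<^sup>2 + (ln y)\<^sup>2 / 2"
          by (simp add: power2_eq_square algebra_simps)
      qed (use y in auto)
      also have "\<dots> = 2 * (g y)\<^sup>2 / y + (ln y)\<^sup>2 / (2 * y)" by (simp add: add_divide_distrib)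
      finally show ?thesis using lny by linarith
    qed
    have lsy: "l y * sqrt y \<le> 1 + (l y)\<^sup>2 * y"
    proof -
      have "0 \<le> (l y * sqrt y - 1 / 2)\<^sup>2" by simp
      then have "l y * sqrt y \<le> 1 + (l y * sqrt y)\<^sup>2" by (simp add: power2_diff power_divide)
      then show ?thesis using y by (simp add: power_mult_distrib)
    qed
    have "real n0 * mgf_error (l y) y \<le> (K * y) * (D * ((l y)\<^sup>2 + l y / sqrt y))"
      using n0 mgf mgf_error_nonneg K y by (intro mult_mono) auto
    also have "\<dots> = K * D * ((l y)\<^sup>2 * y + l y * sqrt y)"
    proof -
      have "y / sqrt y = sqrt y" using y by (simp add: real_div_sqrt)
      then have eq1: "y * (l y / sqrt y) = l y * sqrt y" by (metis mult.commute times_divide_eq_right)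
      have eq2: "(K * y) * (D * ((l y)\<^sup>2 + r)) = K * D * ((l y)\<^sup>2 * y + y * r)" for r
        by (simp add: algebra_simps)
      show ?thesis by (simp only: eq2 eq1)
    qed
    also have "\<dots> \<le> K * D * (3 + 4 * (g y)\<^sup>2 / y)"
      using l2y lsy KD by (intro mult_left_mono) auto
    finally have err: "real n0 * mgf_error (l y) y \<le> 3 * (K * D) + 4 * (K * D) * ((g y)\<^sup>2 / y)"
      by (simp add: algebra_simps)
    let ?Z = "exp (- g y + C * (g y)\<^sup>2 / y)"
    have "4 * (K * D) * ((g y)\<^sup>2 / y) \<le> C * ((g y)\<^sup>2 / y)"
      using Cge y by (intro mult_right_mono) auto
    moreover have "a * l y / 2 \<le> a / 2" using ly1 a_pos by simp
    ultimately have err': "- l y * (y - 0) + a * l y / 2 + real n0 * mgf_error (l y) y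
        \<le> (a / 2 + 3 * (K * D)) + (- ln y / 2) + (- g y + C * (g y)\<^sup>2 / y)"
      using err lyy by (simp add: algebra_simps)
    have "prob {\<omega> \<in> space M. rw_A X \<omega> > y\<^sup>2 / (2 * a)} \<le> mean_length * Fbar M X y
      + prob {\<omega> \<in> space M. (\<Sum>j\<in>{1..n0}. clip_between y y (X j \<omega>)) > 0}
      + (real n0 + 1) * exp (- l y * (y - 0) + a * l y / 2 + real n0 * mgf_error (l y) y)"
      using lpos y n0 by (intro prob_area_le) auto
    also have "prob {\<omega> \<in> space M. (\<Sum>j\<in>{1..n0}. clip_between y y (X j \<omega>)) > 0} = 0"
    proof -
      have "clip_between y y z = 0" for z by (auto simp: clip_between_def)
      then show ?thesis by simp
    qed
    also have "mean_length * Fbar M X y \<le> 2 * mean_length * (sqrt y * ?Z)"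
    proof -
      have "Fbar M X y \<le> 2 * (exp (- g y) / y\<^sup>2)" using y by (intro tail_le) auto
      also have "exp (- g y) / y\<^sup>2 \<le> exp (- g y) / 1"
        using y by (intro divide_left_mono) (auto simp: one_le_power)
      also have "exp (- g y) / 1 \<le> ?Z" using C y by simp
      also have "?Z \<le> sqrt y * ?Z" using y by simp
      finally show ?thesis
        using mean_length_nonneg mult_left_mono[of "Fbar M X y" "2 * (sqrt y * ?Z)" mean_length]
        by (simp add: mult.assoc mult.left_commute)
    qed
    also have "(real n0 + 1) * exp (- l y * (y - 0) + a * l y / 2 + real n0 * mgf_error (l y) y)
        \<le> ((K + 1) * y) * (exp (a / 2 + 3 * (K * D)) * (1 / sqrt y) * ?Z)"
    proof (intro mult_mono)
      show "real n0 + 1 \<le> (K + 1) * y" using n0 y by (simp add: algebra_simps)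
      have "exp (- ln y / 2) = 1 / sqrt y"
        using y by (simp add: exp_minus inverse_eq_divide powr_half_sqrt[symmetric] powr_def)
      then have "exp (a / 2 + 3 * (K * D)) * (1 / sqrt y) * ?Z
          = exp ((a / 2 + 3 * (K * D)) + (- ln y / 2) + (- g y + C * (g y)\<^sup>2 / y))"
        by (simp only: exp_add)
      then show "exp (- l y * (y - 0) + a * l y / 2 + real n0 * mgf_error (l y) y)
          \<le> exp (a / 2 + 3 * (K * D)) * (1 / sqrt y) * ?Z"
        using err' by (simp only: exp_le_cancel_iff)
    qed (use K y in auto)
    also have "((K + 1) * y) * (exp (a / 2 + 3 * (K * D)) * (1 / sqrt y) * ?Z)
        = (K + 1) * exp (a / 2 + 3 * (K * D)) * (sqrt y * ?Z)"
    proof -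
      have eq1: "y * (1 / sqrt y) = sqrt y" using y by (simp add: real_div_sqrt)
      have eq2: "((K + 1) * y) * (r * s * t) = (K + 1) * r * (y * s * t)" for r s t
        by (simp only: mult_ac)
      show ?thesis by (simp only: eq2 eq1)
    qed
    finally have "prob {\<omega> \<in> space M. rw_A X \<omega> > y\<^sup>2 / (2 * a)}
        \<le> (2 * mean_length + (K + 1) * exp (a / 2 + 3 * (K * D))) * (sqrt y * ?Z)"
      by (simp add: algebra_simps)
    also have "\<dots> \<le> C * (sqrt y * ?Z)"
      using Cge y by (intro mult_right_mono) auto
    finally show ?case by (simp add: mult.assoc)
  qed
  with C show ?thesis by blast
qed

text \<open>Here b = \<eta> y and c = v = (1 - d) y. The single jump above \<open>c\<close>, the
  clipped sum with its two steps, and the Chernoff term with a large tilt are each brought to the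
  order of \<open>Z\<close>.\<close>

lemma eventually_prob_area_le_sharp:
  assumes d: "0 < d" "d < 1 / 2" and \<gamma>: "0 < \<gamma>" "\<gamma> < 1"
    and g_power: "\<And>x y. 0 < x \<Longrightarrow> x \<le> y \<Longrightarrow> g y / y powr \<gamma> \<le> g x / x powr \<gamma>"
  shows "\<exists>C>0. \<forall>\<^sub>F y in at_top. prob {\<omega> \<in> space M. rw_A X \<omega> > y\<^sup>2 / (2 * a)}
    \<le> C * (exp (- (1 - 2 * d) * g y) / y\<^sup>2)"
proof -
  obtain t0 where t0: "t0 > 0" and tail_le: "\<And>t. t \<ge> t0 \<Longrightarrow> Fbar M X t \<le> 2 * (exp (- g t) / t\<^sup>2)"
    using tail_bound by blast
  define K where "K = 2 / a + 1"
  \<comment> \<open>Then l (y - c) = 8 (g y + ln y). Two of the eight units pay for the moment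
    generating error, and the rest more than covers exp (- g y) / y^3, one power of \<open>y\<close>
    being spent on the number of lengths.\<close>
  define m where "m = 8 / d"
  \<comment> \<open>The large tilt must be absorbed for t \<le> \<eta> y: the first bound gives
    \<eta> m \<le> 1 / 4 for its logarithmic part, the second m \<eta>^(1 - \<gamma>) \<le> 1 for
    its part in \<open>g\<close>.\<close>
  define \<eta> where "\<eta> = min (1 / (4 * m)) ((1 / m) powr (1 / (1 - \<gamma>)))"
  define D where "D = (second_moment + 36 * exp 1) * (1 + 1 / sqrt \<eta>)"
  define C2 where "C2 = K\<^sup>2 * (2 * (exp 1)\<^sup>2 / \<eta>\<^sup>2)\<^sup>2 * exp 1 * (4 / d\<^sup>2)"
  define C3 where "C3 = (K + 1) * exp (a / 2 + K * D)"
  define C where "C = 8 * mean_length + C2 + C3"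
  have K: "K > 0" using a_pos by (simp add: K_def add_pos_pos)
  have m: "m \<ge> 16" using d by (simp add: m_def field_simps)
  have \<eta>: "0 < \<eta>" "\<eta> * m \<le> 1 / 4" using m by (auto simp: \<eta>_def min_mult_distrib_right)
  have \<eta>1: "\<eta> \<le> 1 / 64"
  proof -
    have "\<eta> \<le> 1 / (4 * m)" by (simp add: \<eta>_def)
    also have "\<dots> \<le> 1 / (4 * 16)" using m by (intro divide_left_mono) auto
    finally show ?thesis by simp
  qed
  have \<eta>_pow: "m * \<eta> powr (1 - \<gamma>) \<le> 1"
  proof -
    have "\<eta> powr (1 - \<gamma>) \<le> ((1 / m) powr (1 / (1 - \<gamma>))) powr (1 - \<gamma>)"
      using \<eta> \<gamma> by (intro powr_mono2) (auto simp: \<eta>_def)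
    also have "\<dots> = 1 / m" using \<gamma> m by (simp add: powr_powr)
    finally show ?thesis using m by (simp add: field_simps)
  qed
  have "0 < second_moment + 36 * exp 1" using second_moment_nonneg by (simp add: add_nonneg_pos)
  then have D: "D > 0" using \<eta> by (simp add: D_def add_pos_pos)
  have C2: "C2 > 0" using K \<eta> d by (simp add: C2_def)
  have C3: "C3 > 0" using K by (simp add: C3_def)
  have C: "C > 0" using mean_length_nonneg C2 C3 by (simp add: C_def add_nonneg_pos)
  define l where "l = (\<lambda>y. m * (g y + 1 * ln y) / y)"
  have l_lim: "(l \<longlongrightarrow> 0) at_top" unfolding l_def by (rule rate_tendsto_0)
  have ev: "\<forall>\<^sub>F y in at_top. l y < min (min 1 (1 / t0)) (2 / (K * D * m))"
    using l_lim t0 K D m by (intro order_tendstoD) auto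
  \<comment> \<open>This makes n0 q \<le> 1, so that (1 + q)^n0 is at most e.\<close>
  have evq: "\<forall>\<^sub>F y in at_top. K * (2 * (exp 1)\<^sup>2 / \<eta>\<^sup>2) * (g y / y + 2 / y) < 1"
  proof (rule order_tendstoD(2))
    have "((\<lambda>y. K * (2 * (exp 1)\<^sup>2 / \<eta>\<^sup>2) * (g y / y + 2 / y)) \<longlongrightarrow> K * (2 * (exp 1)\<^sup>2 / \<eta>\<^sup>2) * (0 + 0)) at_top"
    proof (intro tendsto_mult tendsto_add tendsto_const g_ratio_tendsto)
      show "((\<lambda>y::real. 2 / y) \<longlongrightarrow> 0) at_top" by real_asymp
    qed
    then show "((\<lambda>y. K * (2 * (exp 1)\<^sup>2 / \<eta>\<^sup>2) * (g y / y + 2 / y)) \<longlongrightarrow> 0) at_top" by simp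
  qed simp
  \<comment> \<open>Equivalent to ln y / 4 \<le> ln (\<eta> y) / 2.\<close>
  have evln: "\<forall>\<^sub>F y in at_top. ln y \<ge> - 2 * ln \<eta>" by real_asymp
  have "\<forall>\<^sub>F y in at_top. prob {\<omega> \<in> space M. rw_A X \<omega> > y\<^sup>2 / (2 * a)}
    \<le> C * (exp (- (1 - 2 * d) * g y) / y\<^sup>2)"
    using ev evq evln eventually_length_bounds eventually_gt_at_top[of "1 / \<eta>"]
      eventually_gt_at_top[of 1] eventually_ge_at_top[of "t0 / \<eta>"]
  proof eventually_elim
    case (elim y)
    define n0 where "n0 = nat \<lceil>2 * y / a\<rceil>"
    define b where "b = \<eta> * y"
    define c where "c = (1 - d) * y"
    define \<mu> where "\<mu> = (g y + 1) / y"
    define Z where "Z = exp (- (1 - 2 * d) * g y) / y\<^sup>2"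
    have y: "1 < y" and n0: "real n0 \<le> K * y" "2 * y / a \<le> real n0"
      and ly1: "l y \<le> 1" and lyt: "l y < 1 / t0" and lyK: "l y < 2 / (K * D * m)"
      and lny: "ln y \<ge> - 2 * ln \<eta>"
      and q_small: "K * (2 * (exp 1)\<^sup>2 / \<eta>\<^sup>2) * (g y / y + 2 / y) < 1"
      using elim by (auto simp: n0_def K_def)
    have b1: "1 \<le> b" "t0 \<le> b" using elim \<eta> by (auto simp: b_def field_simps)
    have bc: "b \<le> c"
      unfolding b_def c_def using \<eta>1 d y by (intro mult_right_mono) auto
    have cy: "c \<le> y" "y / 2 \<le> c" "0 < c" using d y by (auto simp: c_def)
    have g0: "0 \<le> g y" using g_nonneg y by simp
    have lpos: "0 < l y" unfolding l_def using g0 y m by (simp add: add_nonneg_pos)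
    have lt: "t0 \<le> 1 / l y" using lyt lpos t0 by (simp add: field_simps)
    have lyy: "l y * y = m * (g y + ln y)" using y by (simp add: l_def)
    have lnpos: "0 \<le> ln y" using y by simp
    have mgf: "mgf_error (l y) b \<le> (second_moment + 36 * exp 1) * ((l y)\<^sup>2 + l y / sqrt b)"
    proof (rule mgf_error_le[OF tail_le lpos lt b1(1)])
      fix t assume t: "1 / l y \<le> t" "t \<le> b"
      have tpos: "0 < t" using t lpos by (meson less_le_trans zero_less_divide_1_iff)
      have ty: "t / y \<le> \<eta>" using t y by (simp add: b_def field_simps)
      \<comment> \<open>Writing t / y as its powers \<gamma> and 1 - \<gamma>, the first is absorbed
        by the power-type monotonicity of \<open>g\<close> and the second beats \<open>m\<close>
        because t / y \<le> \<eta>.\<close>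
      have "m * (t / y) * g y \<le> g t"
      proof -
        have "t \<le> y" using t bc cy by linarith
        from g_power[OF tpos this] have "g y * (t powr \<gamma> / y powr \<gamma>) \<le> g t"
          using tpos y by (simp add: field_simps)
        then have le: "g y * (t / y) powr \<gamma> \<le> g t" using tpos y by (simp add: powr_divide)
        have "t / y = (t / y) powr \<gamma> * (t / y) powr (1 - \<gamma>)"
          using tpos y by (simp flip: powr_add)
        also have "\<dots> \<le> (t / y) powr \<gamma> * \<eta> powr (1 - \<gamma>)"
          using tpos y ty \<gamma> by (intro mult_left_mono powr_mono2) auto
        finally have "m * (t / y) \<le> m * ((t / y) powr \<gamma> * \<eta> powr (1 - \<gamma>))"
          using m by (intro mult_left_mono) auto
        also have "\<dots> = (t / y) powr \<gamma> * (m * \<eta> powr (1 - \<gamma>))" by simp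
        also have "\<dots> \<le> (t / y) powr \<gamma> * 1" by (intro mult_left_mono \<eta>_pow) auto
        finally have "m * (t / y) * g y \<le> (t / y) powr \<gamma> * g y" using g0 by (intro mult_right_mono) auto
        with le show ?thesis by (simp add: mult.commute)
      qed
      moreover have "m * (t / y) * ln y \<le> t / b * (ln b / 2)"
      proof -
        have "m * (t / y) * ln y = t / b * (\<eta> * m * ln y)"
          using y \<eta> by (simp add: b_def)
        also have "\<dots> \<le> t / b * (1 / 4 * ln y)"
          using \<eta> lnpos tpos b1 by (intro mult_left_mono mult_right_mono) auto
        also have "\<dots> \<le> t / b * (ln b / 2)"
          using lny tpos b1 \<eta> y by (intro mult_left_mono) (auto simp: b_def ln_mult)
        finally show ?thesis .
      qed
      moreover have "l y * t = m * (t / y) * g y + m * (t / y) * ln y"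
        by (simp add: l_def add_divide_distrib algebra_simps)
      ultimately show "l y * t \<le> g t + t / b * (ln b / 2)" by simp
    qed
    have "real n0 * mgf_error (l y) b \<le> (K * y) * ((second_moment + 36 * exp 1) * ((l y)\<^sup>2 + l y / sqrt b))"
      using n0 mgf mgf_error_nonneg K y by (intro mult_mono) auto
    also have "\<dots> = K * (second_moment + 36 * exp 1) * ((l y)\<^sup>2 * y + l y * sqrt y / sqrt \<eta>)"
    proof -
      have "y / sqrt y = sqrt y" using y by (simp add: real_div_sqrt)
      then have eq1: "y * (l y / sqrt b) = l y * sqrt y / sqrt \<eta>"
        unfolding b_def real_sqrt_mult
        by (metis divide_divide_eq_left mult.commute times_divide_eq_right)
      have eq2: "(K * y) * (s * ((l y)\<^sup>2 + r)) = K * s * ((l y)\<^sup>2 * y + y * r)" for s r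
        by (simp add: algebra_simps)
      show ?thesis by (simp only: eq2 eq1)
    qed
    also have "\<dots> \<le> K * (second_moment + 36 * exp 1) * ((1 + 1 / sqrt \<eta>) * ((l y)\<^sup>2 * y + 1))"
    proof (rule mult_left_mono)
      have "l y * sqrt y \<le> (l y)\<^sup>2 * y + 1"
      proof -
        have "0 \<le> (l y * sqrt y - 1 / 2)\<^sup>2" by simp
        then have "l y * sqrt y \<le> (l y * sqrt y)\<^sup>2 + 1" by (simp add: power2_diff power_divide)
        then show ?thesis using y by (simp add: power_mult_distrib)
      qed
      then have "l y * sqrt y / sqrt \<eta> \<le> ((l y)\<^sup>2 * y + 1) / sqrt \<eta>"
        using \<eta> by (intro divide_right_mono) auto
      then show "(l y)\<^sup>2 * y + l y * sqrt y / sqrt \<eta> \<le> (1 + 1 / sqrt \<eta>) * ((l y)\<^sup>2 * y + 1)"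
        by (simp add: distrib_right)
    qed (use K second_moment_nonneg in auto)
    also have "\<dots> = K * D * ((l y)\<^sup>2 * y) + K * D" by (simp add: D_def algebra_simps)
    also have "K * D * ((l y)\<^sup>2 * y) \<le> 2 * (g y + ln y)"
    proof -
      have "K * D * ((l y)\<^sup>2 * y) = l y * (K * D * m) * (g y + ln y)"
        using lyy by (simp add: power2_eq_square)
      also have "\<dots> \<le> 2 * (g y + ln y)"
        using lyK K D m g0 lnpos by (intro mult_right_mono) (auto simp: field_simps)
      finally show ?thesis .
    qed
    finally have err: "real n0 * mgf_error (l y) b \<le> 2 * (g y + ln y) + K * D" by simp
    have gd: "- g y \<le> - (1 - 2 * d) * g y"
      using g0 d by (simp add: algebra_simps)
    have third: "(real n0 + 1) * exp (- l y * (y - c) + a * l y / 2 + real n0 * mgf_error (l y) b) \<le> C3 * Z"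
    proof -
      have "l y * (y - c) = 8 * (g y + ln y)"
      proof -
        have "l y * (y - c) = d * (l y * y)" by (simp add: c_def algebra_simps)
        then show ?thesis unfolding lyy using d by (simp add: m_def)
      qed
      moreover have "a * l y / 2 \<le> a / 2" using ly1 a_pos by simp
      ultimately have "- l y * (y - c) + a * l y / 2 + real n0 * mgf_error (l y) b
          \<le> (a / 2 + K * D) + (- g y + - 3 * ln y)"
        using err g0 lnpos by simp
      also have "\<dots> \<le> (a / 2 + K * D) + (- (1 - 2 * d) * g y + - 3 * ln y)" using gd by simp
      finally have "(real n0 + 1) * exp (- l y * (y - c) + a * l y / 2 + real n0 * mgf_error (l y) b)
          \<le> ((K + 1) * y) * exp ((a / 2 + K * D) + (- (1 - 2 * d) * g y + - 3 * ln y))"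
        using n0 y K by (intro mult_mono) (auto simp: algebra_simps)
      also have "exp ((a / 2 + K * D) + (- (1 - 2 * d) * g y + - 3 * ln y))
          = exp (a / 2 + K * D) * (exp (- (1 - 2 * d) * g y) * exp (- 3 * ln y))"
        by (simp only: exp_add)
      also have "exp (- 3 * ln y) = 1 / y ^ 3"
      proof -
        have "exp (3 * ln y) = y ^ 3" using y exp_of_nat_mult[of 3 "ln y"] by simp
        then show ?thesis by (simp add: exp_minus inverse_eq_divide)
      qed
      also have "(K + 1) * y * (exp (a / 2 + K * D) * (exp (- (1 - 2 * d) * g y) * (1 / y ^ 3))) = C3 * Z"
        using y by (simp add: C3_def Z_def power3_eq_cube power2_eq_square)
      finally show ?thesis .
    qed
    have first: "mean_length * Fbar M X c \<le> 8 * mean_length * Z"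
    proof -
      have "Fbar M X c \<le> 2 * (exp (- g c) / c\<^sup>2)" using b1 bc by (intro tail_le) auto
      also have "exp (- g c) / c\<^sup>2 \<le> exp (- (1 - 2 * d) * g y) / (y / 2)\<^sup>2"
      proof (intro frac_le)
        have "g y * (c / y) \<le> g c" using cy by (intro g_mult_le) auto
        then have "(1 - d) * g y \<le> g c" using y by (simp add: c_def mult.commute)
        moreover have "(1 - 2 * d) * g y \<le> (1 - d) * g y" using g0 d by (intro mult_right_mono) auto
        ultimately have "- g c \<le> - (1 - 2 * d) * g y" unfolding mult_minus_left by linarith
        then show "exp (- g c) \<le> exp (- (1 - 2 * d) * g y)" by (simp only: exp_le_cancel_iff)
        show "(y / 2)\<^sup>2 \<le> c\<^sup>2" using cy y by (intro power_mono) auto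
      qed (use y in auto)
      also have "exp (- (1 - 2 * d) * g y) / (y / 2)\<^sup>2 = 4 * Z" by (simp add: Z_def power_divide)
      finally show ?thesis
        using mean_length_nonneg mult_left_mono[of "Fbar M X c" "2 * (4 * Z)" mean_length] by simp
    qed
    have second: "prob {\<omega> \<in> space M. (\<Sum>j\<in>{1..n0}. clip_between b c (X j \<omega>)) > c} \<le> C2 * Z"
    proof -
      define q where "q = exp_tail \<mu> b c"
      define Q where "Q = 2 * (exp 1)\<^sup>2 / \<eta>\<^sup>2"
      have \<mu>: "0 < \<mu>" using g0 y by (simp add: \<mu>_def)
      have q0: "0 \<le> q" unfolding q_def by (rule exp_tail_nonneg)
      have Q0: "0 < Q" using \<eta> by (simp add: Q_def)
      have "q \<le> 2 * (exp 1)\<^sup>2 * (g y + 2) / b\<^sup>2"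
        unfolding q_def \<mu>_def by (rule exp_tail_le[OF tail_le b1(2) _ bc cy(1)]) (use b1 in auto)
      also have "\<dots> = Q * (g y + 2) / y\<^sup>2" by (simp add: Q_def b_def power_mult_distrib)
      finally have q: "q \<le> Q * (g y + 2) / y\<^sup>2" .
      have n0q: "real n0 * q \<le> K * Q * (g y + 2) / y"
      proof -
        have "real n0 * q \<le> (K * y) * (Q * (g y + 2) / y\<^sup>2)"
          using n0 q q0 K y by (intro mult_mono) auto
        also have "\<dots> = K * Q * (g y + 2) / y" using y by (simp add: power2_eq_square)
        finally show ?thesis .
      qed
      have "(1 + q) ^ n0 \<le> exp 1"
      proof -
        have "(1 + q) ^ n0 \<le> exp q ^ n0" using q0 by (intro power_mono) auto
        also have "\<dots> = exp (real n0 * q)" by (simp add: exp_of_nat_mult)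
        also have "\<dots> \<le> exp 1"
        proof -
          have "K * Q * (g y + 2) / y = K * Q * (g y / y + 2 / y)" by (simp flip: add_divide_distrib)
          then show ?thesis using n0q q_small unfolding Q_def[symmetric] by simp
        qed
        finally show ?thesis .
      qed
      \<comment> \<open>The square of n0 q supplies the factor 1 / y^2. Its polynomial factor in g y
        is absorbed into exp (d g y), which lowers the rate from 1 - d to 1 - 2 d.\<close>
      moreover have "(real n0 * q)\<^sup>2 \<le> K\<^sup>2 * Q\<^sup>2 * ((4 / d\<^sup>2) * exp (d * g y)) / y\<^sup>2"
      proof -
        have "(g y + 2)\<^sup>2 \<le> (4 / d\<^sup>2) * exp (d * g y)"
        proof -
          have "g y + 2 \<le> 2 / d * (1 + d * g y / 2)" using d by (simp add: field_simps)
          also have "\<dots> \<le> 2 / d * exp (d * g y / 2)"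
            using d by (intro mult_left_mono exp_ge_add_one_self) auto
          finally have "(g y + 2)\<^sup>2 \<le> (2 / d * exp (d * g y / 2))\<^sup>2" using g0 by (intro power_mono) auto
          also have "\<dots> = 4 / d\<^sup>2 * exp (d * g y)" by (simp add: power_mult_distrib power_divide flip: exp_double)
          finally show ?thesis .
        qed
        then have "K\<^sup>2 * Q\<^sup>2 * (g y + 2)\<^sup>2 / y\<^sup>2 \<le> K\<^sup>2 * Q\<^sup>2 * ((4 / d\<^sup>2) * exp (d * g y)) / y\<^sup>2"
          by (intro divide_right_mono mult_left_mono) auto
        moreover have "(real n0 * q)\<^sup>2 \<le> (K * Q * (g y + 2) / y)\<^sup>2"
          using n0q q0 by (intro power_mono) auto
        ultimately show ?thesis by (simp add: power_mult_distrib power_divide)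
      qed
      moreover have "exp (- \<mu> * c) \<le> exp (- (1 - d) * g y)"
      proof -
        have "\<mu> * c = (1 - d) * (g y + 1)" using y by (simp add: \<mu>_def c_def)
        then show ?thesis using d by (simp add: algebra_simps)
      qed
      ultimately have "(real n0 * q)\<^sup>2 * (1 + q) ^ n0 * exp (- \<mu> * c)
          \<le> (K\<^sup>2 * Q\<^sup>2 * ((4 / d\<^sup>2) * exp (d * g y)) / y\<^sup>2) * exp 1 * exp (- (1 - d) * g y)"
        using q0 by (intro mult_mono) auto
      also have "\<dots> = K\<^sup>2 * Q\<^sup>2 * exp 1 * (4 / d\<^sup>2) * ((exp (d * g y) * exp (- (1 - d) * g y)) / y\<^sup>2)"
        by simp
      also have "exp (d * g y) * exp (- (1 - d) * g y) = exp (- (1 - 2 * d) * g y)"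
        by (simp add: algebra_simps flip: exp_add)
      also have "K\<^sup>2 * Q\<^sup>2 * exp 1 * (4 / d\<^sup>2) * (exp (- (1 - 2 * d) * g y) / y\<^sup>2) = C2 * Z"
        by (simp add: C2_def Z_def Q_def)
      finally have "(real n0 * q)\<^sup>2 * (1 + q) ^ n0 * exp (- \<mu> * c) \<le> C2 * Z" .
      moreover have "prob {\<omega> \<in> space M. (\<Sum>j\<in>{1..n0}. clip_between b c (X j \<omega>)) > c}
          \<le> (real n0)\<^sup>2 * q\<^sup>2 * (1 + q) ^ n0 * exp (- \<mu> * c)"
        unfolding q_def using b1 bc \<mu> by (intro prob_sum_clip_between_le) auto
      ultimately show ?thesis by (simp add: power_mult_distrib)
    qed
    have "prob {\<omega> \<in> space M. rw_A X \<omega> > y\<^sup>2 / (2 * a)} \<le> mean_length * Fbar M X c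
      + prob {\<omega> \<in> space M. (\<Sum>j\<in>{1..n0}. clip_between b c (X j \<omega>)) > c}
      + (real n0 + 1) * exp (- l y * (y - c) + a * l y / 2 + real n0 * mgf_error (l y) b)"
      using lpos y n0 b1 bc cy by (intro prob_area_le) auto
    also have "\<dots> \<le> 8 * mean_length * Z + C2 * Z + C3 * Z"
      by (intro add_mono first second third)
    finally show ?case by (simp only: C_def Z_def distrib_right)
  qed
  with C show ?thesis by blast
qed

end

section \<open>Final inequalities and passage from height to area\<close>

lemma sqrt_one_minus_le: "u \<le> 2 \<Longrightarrow> sqrt (1 - u) \<le> 1 - u / 2"
  by (rule real_le_lsqrt) (simp_all add: power2_eq_square algebra_simps)

text \<open>\<open>p\<close> and \<open>f\<close> stand for the negative logarithms of the area
  probability and of the tail, \<open>G\<close> for g y + 2 ln y. The condition 3 c < d G absorbs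
  the bounded errors into the relative error.\<close>

lemma ratio_near_1:
  fixes p f G c d :: real
  assumes d: "0 < d" "d \<le> 1 / 4" and c: "0 \<le> c" and G: "3 * c < d * G"
    and p: "(1 - 2 * d) * G - c \<le> p" "p \<le> (1 + d) * G + c" and f: "G - c \<le> f" "f \<le> G + c"
  shows "\<bar>p / f - 1\<bar> \<le> 3 * d"
proof -
  have G0: "0 < G" using c G d by (smt (verit) mult_nonneg_nonpos)
  have "d * G \<le> 1 * G" using G0 d by (intro mult_right_mono) auto
  then have f0: "0 < f" using f G c by linarith
  have dc: "3 * d * c \<le> c" using d c by (simp add: mult_left_le_one_le)
  have "p \<le> (1 + 3 * d) * (G - c)" using p G dc by (simp add: algebra_simps)
  also have "\<dots> \<le> (1 + 3 * d) * f" using f d by (intro mult_left_mono) auto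
  finally have 1: "p \<le> (1 + 3 * d) * f" .
  have "(1 - 3 * d) * f \<le> (1 - 3 * d) * (G + c)" using f d by (intro mult_left_mono) auto
  also have "(1 - 3 * d) * (G + c) = G + c - 3 * (d * G) - 3 * (d * c)" by (simp add: algebra_simps)
  also have "\<dots> \<le> G - 2 * (d * G) - c" using G c d mult_nonneg_nonneg[of d c] by linarith
  also have "\<dots> \<le> p" using p by (simp add: algebra_simps)
  finally have 2: "(1 - 3 * d) * f \<le> p" .
  have "p / f \<le> 1 + 3 * d" "1 - 3 * d \<le> p / f"
    using 1 2 f0 by (simp_all add: field_simps)
  then show ?thesis by (simp add: abs_le_iff)
qed

context subexponential_walk begin

lemma filterlim_peak: "filterlim (\<lambda>x. sqrt (2 * a * x)) at_top at_top"
  using a_pos by real_asymp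

text \<open>The substitution y = sqrt (2 a x) turns y^2 / (2 a) into \<open>x\<close>; the abstract
  predicate allows one transfer for all upper bounds.\<close>

lemma eventually_peak:
  assumes "\<forall>\<^sub>F y in at_top. P (prob {\<omega> \<in> space M. rw_A X \<omega> > y\<^sup>2 / (2 * a)}) y"
  shows "\<forall>\<^sub>F x in at_top. P (prob {\<omega> \<in> space M. rw_A X \<omega> > x}) (sqrt (2 * a * x))"
  using eventually_compose_filterlim[OF assms filterlim_peak] eventually_ge_at_top[of 0]
proof eventually_elim
  case (elim x)
  have "(sqrt (2 * a * x))\<^sup>2 / (2 * a) = x" using elim a_pos by simp
  then show ?case using elim by simp
qed

text \<open>Applying sqrt (1 - u) \<le> 1 - u / 2 with u = 2 C g y / (a y) converts the additive
  correction (g y)^2 / y into the square-root form.\<close>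

lemma upper_bound:
  "\<exists>C>0. \<forall>\<^sub>F x in at_top. prob {\<omega> \<in> space M. rw_A X \<omega> > x}
    \<le> C * x powr (1/4) * exp (- (g (sqrt (2*a*x)) * sqrt (1 - 2 * C * g (sqrt (2*a*x)) / (a * sqrt (2*a*x)))))"
proof -
  obtain C0 where C0: "C0 > 0" and ev: "\<forall>\<^sub>F y in at_top. prob {\<omega> \<in> space M. rw_A X \<omega> > y\<^sup>2 / (2 * a)}
      \<le> C0 * sqrt y * exp (- g y + C0 * (g y)\<^sup>2 / y)"
    using eventually_prob_area_le by blast
  \<comment> \<open>The same constant must serve as prefactor, where sqrt y = (2 a)^(1/4) x^(1/4),
    and inside the root, where C / a has to reach \<open>C0\<close>.\<close>
  define C where "C = max (C0 * (2 * a) powr (1/4)) (a * C0)"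
  have C: "C > 0" "C0 * (2 * a) powr (1/4) \<le> C" "C0 \<le> C / a"
    using C0 a_pos by (auto simp: C_def field_simps less_max_iff_disj)
  have "((\<lambda>y. 2 * C / a * (g y / y)) \<longlongrightarrow> 2 * C / a * 0) at_top"
    by (intro tendsto_mult tendsto_const g_ratio_tendsto)
  then have "\<forall>\<^sub>F y in at_top. 2 * C / a * (g y / y) < 2" by (intro order_tendstoD) auto
  then have "\<forall>\<^sub>F y in at_top. prob {\<omega> \<in> space M. rw_A X \<omega> > y\<^sup>2 / (2 * a)}
      \<le> C0 * sqrt y * exp (- (g y * sqrt (1 - 2 * C * g y / (a * y))))"
    using ev eventually_gt_at_top[of 0]
  proof eventually_elim
    case (elim y)
    have g0: "0 \<le> g y" using elim g_nonneg by simp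
    have "sqrt (1 - 2 * C * g y / (a * y)) \<le> 1 - 2 * C * g y / (a * y) / 2"
      using elim by (intro sqrt_one_minus_le) simp
    then have "g y * sqrt (1 - 2 * C * g y / (a * y)) \<le> g y * (1 - 2 * C * g y / (a * y) / 2)"
      using g0 by (intro mult_left_mono)
    also have "\<dots> = g y - C / a * ((g y)\<^sup>2 / y)"
      by (simp add: power2_eq_square algebra_simps)
    also have "\<dots> \<le> g y - C0 * ((g y)\<^sup>2 / y)"
      using C elim by (intro diff_left_mono mult_right_mono) auto
    finally have "exp (- g y + C0 * (g y)\<^sup>2 / y) \<le> exp (- (g y * sqrt (1 - 2 * C * g y / (a * y))))" by simp
    then have "C0 * sqrt y * exp (- g y + C0 * (g y)\<^sup>2 / y)
        \<le> C0 * sqrt y * exp (- (g y * sqrt (1 - 2 * C * g y / (a * y))))"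
      using C0 elim by (intro mult_left_mono) auto
    then show ?case using elim by linarith
  qed
  from eventually_peak[where P = "\<lambda>p y. p \<le> C0 * sqrt y * exp (- (g y * sqrt (1 - 2 * C * g y / (a * y))))", OF this]
  have "\<forall>\<^sub>F x in at_top. prob {\<omega> \<in> space M. rw_A X \<omega> > x}
    \<le> C * x powr (1/4) * exp (- (g (sqrt (2*a*x)) * sqrt (1 - 2 * C * g (sqrt (2*a*x)) / (a * sqrt (2*a*x)))))"
    using eventually_gt_at_top[of 0]
  proof eventually_elim
    case (elim x)
    have "sqrt (sqrt (2 * a * x)) = (2 * a * x) powr (1/4)"
      using elim a_pos by (simp add: powr_half_sqrt[symmetric] powr_powr)
    also have "\<dots> = (2 * a) powr (1/4) * x powr (1/4)" by (rule powr_mult)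
    finally have "C0 * sqrt (sqrt (2 * a * x)) = C0 * (2 * a) powr (1/4) * x powr (1/4)" by simp
    also have "\<dots> \<le> C * x powr (1/4)" using C by (intro mult_right_mono) auto
    finally have "C0 * sqrt (sqrt (2 * a * x)) * exp (- (g (sqrt (2*a*x)) * sqrt (1 - 2 * C * g (sqrt (2*a*x)) / (a * sqrt (2*a*x)))))
        \<le> C * x powr (1/4) * exp (- (g (sqrt (2*a*x)) * sqrt (1 - 2 * C * g (sqrt (2*a*x)) / (a * sqrt (2*a*x)))))"
      by (intro mult_right_mono) auto
    then show ?case using elim by linarith
  qed
  with C show ?thesis by blast
qed

subsection \<open>The lower bound\<close>

lemma Fbar_pos: "\<forall>\<^sub>F t in at_top. 0 < Fbar M X t"
  using Fbar_bounds eventually_gt_at_top[of 0]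
proof eventually_elim
  case (elim t)
  have "0 < exp (- g t) / t\<^sup>2 / 2" using elim by simp
  then show ?case using elim by linarith
qed

lemma filterlim_peak_shift:
  "filterlim (\<lambda>x. sqrt (2 * a * x) + 1 * x powr e) at_top at_top"
  by (rule filterlim_at_top_mono[OF filterlim_peak]) simp

text \<open>\<open>prob_area_ge\<close> with \<open>w\<close> equal to half the shift. As w^2 has
  order x^(1/2 + 2 e), the fluctuation error tends to zero, and so does the tail at
  \<open>h x\<close>; for fixed \<open>N\<close> the coefficient therefore tends to the partial sum
  of E \<tau>.\<close>

lemma eventually_ratio_gt:
  assumes e: "e > 0" and z: "z < (\<Sum>k\<in>{1..N}. alive_prob k)"
  shows "\<forall>\<^sub>F x in at_top. z < prob {\<omega> \<in> space M. rw_A X \<omega> > x}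
    / Fbar M X (sqrt (2 * a * x) + 1 * x powr (1 / 4 + e))"
proof -
  define w where "w = (\<lambda>x. x powr (1 / 4 + e) / 2)"
  define h where "h = (\<lambda>x. sqrt (2 * a * x) + 1 * x powr (1 / 4 + e))"
  define \<rho> where "\<rho> = (\<lambda>x. (sqrt (2 * a * x) + w x) / a * second_moment / (w x)\<^sup>2)"
  define r where "r = (\<lambda>x. (1 - \<rho> x) * (\<Sum>k\<in>{1..N}. alive_prob k - real N * Fbar M X (h x)))"
  have "((\<lambda>x. (sqrt (2 * a * x) + w x) / (w x)\<^sup>2) \<longlongrightarrow> 0) at_top"
  proof (rule Lim_transform_eventually)
    show "((\<lambda>x::real. 4 * sqrt (2 * a) * x powr (- 2 * e) + 2 * x powr (- (1 / 4 + e))) \<longlongrightarrow> 0) at_top"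
      using e by (intro tendsto_add_zero tendsto_mult_right_zero tendsto_neg_powr filterlim_ident) auto
    show "\<forall>\<^sub>F x in at_top. 4 * sqrt (2 * a) * x powr (- 2 * e) + 2 * x powr (- (1 / 4 + e))
        = (sqrt (2 * a * x) + w x) / (w x)\<^sup>2"
      using eventually_gt_at_top[of 0]
    proof eventually_elim
      case (elim x)
      define v where "v = x powr (1 / 4 + e)"
      have v: "0 < v" using elim by (simp add: v_def)
      have "sqrt (2 * a * x) = sqrt (2 * a) * sqrt x" by (simp add: real_sqrt_mult)
      also have "sqrt x = x powr (- 2 * e) * v\<^sup>2"
        using elim by (simp add: v_def powr_half_sqrt[symmetric] power2_eq_square flip: powr_add)
      finally have 1: "sqrt (2 * a * x) = sqrt (2 * a) * x powr (- 2 * e) * v\<^sup>2" by simp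
      have 2: "x powr (- (1 / 4 + e)) = 1 / v" by (simp only: v_def powr_minus_divide)
      have 3: "w x = v / 2" by (simp add: w_def v_def)
      show ?case unfolding 1 2 3 using v by (simp add: field_simps power2_eq_square)
    qed
  qed
  then have "((\<lambda>x. second_moment / a * ((sqrt (2 * a * x) + w x) / (w x)\<^sup>2)) \<longlongrightarrow> second_moment / a * 0) at_top"
    by (intro tendsto_mult tendsto_const)
  then have \<rho>: "(\<rho> \<longlongrightarrow> 0) at_top"
    unfolding \<rho>_def by (simp add: mult.commute)
  have Fh: "((\<lambda>x. Fbar M X (h x)) \<longlongrightarrow> 0) at_top"
    unfolding h_def by (rule filterlim_compose[OF Fbar_tendsto_0 filterlim_peak_shift])
  have "(r \<longlongrightarrow> (1 - 0) * (\<Sum>k\<in>{1..N}. alive_prob k - real N * 0)) at_top"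
    unfolding r_def by (intro tendsto_mult tendsto_diff tendsto_const \<rho> tendsto_sum Fh)
  then have "\<forall>\<^sub>F x in at_top. z < r x" using z by (intro order_tendstoD) auto
  moreover have "\<forall>\<^sub>F x in at_top. \<rho> x < 1" using \<rho> by (intro order_tendstoD) auto
  moreover have "\<forall>\<^sub>F x in at_top. 0 < Fbar M X (h x)"
    unfolding h_def by (rule eventually_compose_filterlim[OF Fbar_pos filterlim_peak_shift])
  ultimately show ?thesis
    using eventually_gt_at_top[of 0]
  proof eventually_elim
    case (elim x)
    define y where "y = sqrt (2 * a * x)"
    have y: "0 < y" "y\<^sup>2 / (2 * a) = x" using elim a_pos by (auto simp: y_def)
    have w: "0 < w x" using elim by (simp add: w_def)
    have h: "h x = y + 2 * w x" by (simp add: h_def y_def w_def)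
    have "real (nat \<lfloor>(y + w x) / a\<rfloor>) \<le> (y + w x) / a" using y w a_pos by simp
    then have "real (nat \<lfloor>(y + w x) / a\<rfloor>) * second_moment / (w x)\<^sup>2 \<le> \<rho> x"
      unfolding \<rho>_def y_def[symmetric] using second_moment_nonneg
      by (intro divide_right_mono mult_right_mono) auto
    from prob_area_ge[OF y(1) w this, of N] elim
    have "Fbar M X (h x) * r x \<le> prob {\<omega> \<in> space M. rw_A X \<omega> > x}"
      unfolding h[symmetric] y(2) r_def by (simp add: mult.assoc)
    then have "r x \<le> prob {\<omega> \<in> space M. rw_A X \<omega> > x} / Fbar M X (h x)"
      using elim by (simp add: field_simps)
    then show ?case using elim unfolding h_def by linarith
  qed
qed

text \<open>Every real below E \<tau> is exceeded by a partial sum of P(\<tau> \<ge> k), so a finite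
  \<open>N\<close> can be fixed before \<open>x\<close> grows.\<close>

lemma lower_bound:
  assumes e: "e > 0"
  shows "ereal (expectation (\<lambda>\<omega>. real (rw_tau X \<omega>))) \<le>
    Liminf at_top (\<lambda>x. ereal (prob {\<omega> \<in> space M. rw_A X \<omega> > x}
      / Fbar M X (sqrt (2 * a * x) + 1 * x powr (1 / 4 + e))))"
  unfolding le_Liminf_iff
proof (intro allI impI)
  fix z assume z: "z < ereal (expectation (\<lambda>\<omega>. real (rw_tau X \<omega>)))"
  also have "\<dots> \<le> ereal mean_length" using expectation_tau_le by simp
  finally have zm: "z < ereal mean_length" .
  show "\<forall>\<^sub>F x in at_top. z < ereal (prob {\<omega> \<in> space M. rw_A X \<omega> > x}
      / Fbar M X (sqrt (2 * a * x) + 1 * x powr (1 / 4 + e)))"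
  proof (cases z)
    case (real r)
    have "(\<lambda>N. \<Sum>j<N. alive_prob (Suc j)) \<longlonglongrightarrow> mean_length"
      unfolding mean_length_def by (rule summable_LIMSEQ[OF summable_alive_prob])
    from order_tendstoD(1)[OF this, of r] zm real
    obtain N where "r < (\<Sum>j<N. alive_prob (Suc j))"
      by (auto simp: eventually_sequentially)
    then have "r < (\<Sum>k\<in>{1..N}. alive_prob k)" by (simp add: sum.atLeast1_atMost_eq)
    from eventually_ratio_gt[OF e this] show ?thesis by (simp add: real)
  qed (use zm in auto)
qed

subsection \<open>Logarithmic asymptotics\<close>

text \<open>Both negative logarithms equal G = g y + 2 ln y up to relative errors of order
  \<open>d\<close> and additive constants, and \<open>G\<close> tends to infinity through its
  logarithmic part.\<close>

lemma log_asymptotics: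
  assumes \<gamma>: "0 < \<gamma>" "\<gamma> < 1"
    and g_power: "\<And>x y. 0 < x \<Longrightarrow> x \<le> y \<Longrightarrow> g y / y powr \<gamma> \<le> g x / x powr \<gamma>"
  shows "((\<lambda>x. ln (prob {\<omega> \<in> space M. rw_A X \<omega> > x}) / ln (Fbar M X (sqrt (2 * a * x)))) \<longlongrightarrow> 1) at_top"
  unfolding tendsto_iff
proof (intro allI impI)
  fix e :: real assume e: "e > 0"
  define d where "d = min (e / 4) (1 / 4)"
  have d: "0 < d" "d \<le> 1 / 4" "d < 1 / 2" "3 * d < e" using e by (auto simp: d_def)
  obtain C where C: "C > 0" and up: "\<forall>\<^sub>F y in at_top. prob {\<omega> \<in> space M. rw_A X \<omega> > y\<^sup>2 / (2 * a)}
      \<le> C * (exp (- (1 - 2 * d) * g y) / y\<^sup>2)"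
    using eventually_prob_area_le_sharp[OF d(1,3) \<gamma> g_power] by blast
  \<comment> \<open>Any exponent strictly between 1/4 and 1/2 would do: the shift is then of smaller
    order than the peak.\<close>
  define h where "h = (\<lambda>x. sqrt (2 * a * x) + 1 * x powr (1 / 4 + 1 / 8))"
  \<comment> \<open>ln 4 collects the factor 2 of the tail bound and the ratio 1 / 2 in
    \<open>low\<close>; 2 d comes from 2 ln (h x) \<le> 2 (d + ln y).\<close>
  define c where "c = \<bar>ln C\<bar> + ln 4 + 2 * d"
  have "0 \<le> ln (2::real)" "ln 2 \<le> ln (4::real)" by simp_all
  then have c: "0 \<le> c" "ln 2 \<le> c" "ln C \<le> c" "ln 4 + 2 * d \<le> c"
    using d abs_ge_self[of "ln C"] abs_ge_zero[of "ln C"] unfolding c_def by linarith+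
  \<comment> \<open>One summand suffices here, since constant factors disappear in the ratio of
    logarithms.\<close>
  have "alive_prob 1 = 1" by (simp add: alive_prob_def prob_space)
  then have low: "\<forall>\<^sub>F x in at_top. 1 / 2 < prob {\<omega> \<in> space M. rw_A X \<omega> > x} / Fbar M X (h x)"
    unfolding h_def by (intro eventually_ratio_gt[of "1/8" _ 1]) auto
  have Fh: "\<forall>\<^sub>F x in at_top. 0 < Fbar M X (h x)"
    unfolding h_def by (rule eventually_compose_filterlim[OF Fbar_pos filterlim_peak_shift])
  have Fhb: "\<forall>\<^sub>F x in at_top. exp (- g (h x)) / (h x)\<^sup>2 / 2 \<le> Fbar M X (h x) \<and> Fbar M X (h x) \<le> 2 * (exp (- g (h x)) / (h x)\<^sup>2)"
    unfolding h_def by (rule eventually_compose_filterlim[OF Fbar_bounds filterlim_peak_shift])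
  have Fy: "\<forall>\<^sub>F x in at_top. exp (- g (sqrt (2 * a * x))) / (sqrt (2 * a * x))\<^sup>2 / 2 \<le> Fbar M X (sqrt (2 * a * x))
      \<and> Fbar M X (sqrt (2 * a * x)) \<le> 2 * (exp (- g (sqrt (2 * a * x))) / (sqrt (2 * a * x))\<^sup>2)"
    by (rule eventually_compose_filterlim[OF Fbar_bounds filterlim_peak])
  have hy: "\<forall>\<^sub>F x in at_top. h x \<le> (1 + d) * sqrt (2 * a * x)"
    unfolding h_def using a_pos d by real_asymp
  have big: "\<forall>\<^sub>F x in at_top. 3 * c < d * (2 * ln (sqrt (2 * a * x)))"
    using a_pos d by real_asymp
  have y1: "\<forall>\<^sub>F x in at_top. 1 < sqrt (2 * a * x)" using a_pos by real_asymp
  show "\<forall>\<^sub>F x in at_top. dist (ln (prob {\<omega> \<in> space M. rw_A X \<omega> > x}) / ln (Fbar M X (sqrt (2 * a * x)))) 1 < e"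
    using eventually_peak[where P = "\<lambda>p y. p \<le> C * (exp (- (1 - 2 * d) * g y) / y\<^sup>2)", OF up]
      low Fh Fhb Fy hy big y1 eventually_gt_at_top[of 0]
  proof eventually_elim
    case (elim x)
    define y where "y = sqrt (2 * a * x)"
    define P where "P = prob {\<omega> \<in> space M. rw_A X \<omega> > x}"
    define G where "G = g y + 2 * ln y"
    have y: "1 < y" using elim by (simp add: y_def)
    have h: "y \<le> h x" "h x \<le> (1 + d) * y" using elim by (auto simp: y_def h_def)
    have g0: "0 \<le> g y" using y g_nonneg by simp
    have lny: "0 < ln y" using y by simp
    have ln_tail: "ln (exp (- s) / t\<^sup>2) = - (s + 2 * ln t)" if "0 < t" for s t :: real
      using that by (simp add: ln_div ln_realpow)
    have G: "3 * c < d * G"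
    proof -
      have "d * (2 * ln y) \<le> d * G" using g0 d by (intro mult_left_mono) (auto simp: G_def)
      then show ?thesis using elim by (simp add: y_def)
    qed
    have F1: "- ln (Fbar M X y) \<le> G + c" and F2: "G - c \<le> - ln (Fbar M X y)"
    proof -
      have pos: "0 < exp (- g y) / y\<^sup>2" using y by simp
      have lo: "exp (- g y) / y\<^sup>2 / 2 \<le> Fbar M X y" and hi: "Fbar M X y \<le> 2 * (exp (- g y) / y\<^sup>2)"
        using elim by (simp_all add: y_def)
      have Fp: "0 < Fbar M X y" using lo pos by (meson half_gt_zero less_le_trans)
      have "ln (exp (- g y) / y\<^sup>2 / 2) \<le> ln (Fbar M X y)"
        using lo pos Fp by (subst ln_le_cancel_iff) auto
      moreover have "ln (exp (- g y) / y\<^sup>2 / 2) = - G - ln 2"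
        using pos y ln_tail[of y "g y"] by (subst ln_div) (auto simp: G_def)
      ultimately show "- ln (Fbar M X y) \<le> G + c" using c by linarith
      have "ln (Fbar M X y) \<le> ln (2 * (exp (- g y) / y\<^sup>2))"
        using hi pos Fp by (subst ln_le_cancel_iff) auto
      moreover have "ln (2 * (exp (- g y) / y\<^sup>2)) = ln 2 - G"
        using pos y ln_tail[of y "g y"] by (subst ln_mult) (auto simp: G_def)
      ultimately show "G - c \<le> - ln (Fbar M X y)" using c by linarith
    qed
    have PF: "Fbar M X (h x) / 2 < P"
      using elim by (simp add: P_def field_simps)
    then have Ppos: "0 < P" using elim by linarith
    have P1: "- ln P \<le> (1 + d) * G + c"
    proof -
      have hpos: "0 < h x" using h y by linarith
      have pos: "0 < exp (- g (h x)) / (h x)\<^sup>2" using hpos by simp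
      have "exp (- g (h x)) / (h x)\<^sup>2 / 4 = exp (- g (h x)) / (h x)\<^sup>2 / 2 / 2" by simp
      also have "\<dots> \<le> Fbar M X (h x) / 2" using elim by (intro divide_right_mono) auto
      finally have "exp (- g (h x)) / (h x)\<^sup>2 / 4 \<le> P" using PF by (rule order.trans[OF _ less_imp_le])
      then have "ln (exp (- g (h x)) / (h x)\<^sup>2 / 4) \<le> ln P"
        using pos Ppos by (subst ln_le_cancel_iff) auto
      moreover have "ln (exp (- g (h x)) / (h x)\<^sup>2 / 4) = - (g (h x) + 2 * ln (h x)) - ln 4"
        using pos hpos ln_tail[of "h x" "g (h x)"] by (subst ln_div) auto
      moreover have "g (h x) \<le> (1 + d) * g y"
      proof -
        have "g (h x) \<le> g y * (h x / y)" using g_ratio[of y "h x"] h y hpos by (simp add: field_simps)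
        also have "\<dots> \<le> g y * (1 + d)"
          using h y g0 by (intro mult_left_mono) (auto simp: field_simps)
        finally show ?thesis by (simp add: mult.commute)
      qed
      moreover have "ln (h x) \<le> d + ln y"
      proof -
        have "ln (h x) \<le> ln ((1 + d) * y)" using h hpos y d by (subst ln_le_cancel_iff) auto
        also have "\<dots> = ln (1 + d) + ln y" using y d by (intro ln_mult_pos) auto
        finally show ?thesis using ln_add_one_self_le_self[of d] d by linarith
      qed
      moreover have "0 \<le> d * ln y" using d lny by simp
      moreover have "(1 + d) * G = (1 + d) * g y + 2 * ln y + 2 * (d * ln y)"
        by (simp add: G_def algebra_simps)
      ultimately show ?thesis using c by linarith
    qed
    have P2: "(1 - 2 * d) * G - c \<le> - ln P"
    proof -
      have pos: "0 < exp (- (1 - 2 * d) * g y) / y\<^sup>2" using y by simp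
      have "P \<le> C * (exp (- (1 - 2 * d) * g y) / y\<^sup>2)" using elim by (simp add: P_def y_def)
      then have "ln P \<le> ln (C * (exp (- (1 - 2 * d) * g y) / y\<^sup>2))"
        using Ppos pos C by (subst ln_le_cancel_iff) auto
      also have "\<dots> = ln C - ((1 - 2 * d) * g y + 2 * ln y)"
      proof -
        have "ln (exp (- (1 - 2 * d) * g y) / y\<^sup>2) = - ((1 - 2 * d) * g y + 2 * ln y)"
          using y ln_tail[of y "(1 - 2 * d) * g y"] by (simp only: mult_minus_left)
        then show ?thesis using ln_mult_pos[OF C pos] by linarith
      qed
      finally have "ln P \<le> ln C - ((1 - 2 * d) * g y + 2 * ln y)" .
      moreover have "0 \<le> d * ln y" using d lny by simp
      moreover have "(1 - 2 * d) * G = (1 - 2 * d) * g y + 2 * ln y - 4 * (d * ln y)"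
        by (simp add: G_def algebra_simps)
      ultimately show ?thesis using c by linarith
    qed
    have "\<bar>(- ln P) / (- ln (Fbar M X y)) - 1\<bar> \<le> 3 * d"
      by (rule ratio_near_1[OF d(1,2) c(1) G P2 P1 F2 F1])
    then show ?case using d by (simp add: dist_real_def P_def y_def)
  qed
qed

end

theorem theorem1:
  fixes M :: "'a measure" and X :: "nat \<Rightarrow> 'a \<Rightarrow> real"
    and a :: real and g :: "real \<Rightarrow> real"
  assumes "prob_space M"
    and "\<And>k. X k \<in> borel_measurable M"
    and "prob_space.indep_vars M (\<lambda>_. borel) X {1..}"
    and "\<And>k. k \<ge> 1 \<Longrightarrow> distr M borel (X k) = distr M borel (X 1)"
    and "a > 0"
    and "integrable M (\<lambda>\<omega>. (X 1 \<omega>)\<^sup>2)"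
    and "prob_space.expectation M (X 1) = - a"
    and "(\<lambda>x. Fbar M X x) \<sim>[at_top] (\<lambda>x. exp (- g x) / x\<^sup>2)"
    and "\<exists>g'. (\<forall>x>0. (g has_real_derivative g' x) (at x)) \<and> continuous_on {0<..} g'"
    and "\<exists>x0. \<forall>x y. x0 \<le> x \<longrightarrow> x \<le> y \<longrightarrow> g x \<le> g y"
    and "\<And>x y. 0 < x \<Longrightarrow> x \<le> y \<Longrightarrow> g y / y \<le> g x / x"
    and "((\<lambda>x. g x / x) \<longlongrightarrow> 0) at_top"
  shows
    "(\<exists>C>0. \<forall>\<^sub>F x in at_top.
        measure M {\<omega> \<in> space M. rw_A X \<omega> > x}
          \<le> C * x powr (1/4) *
             exp (- (g (sqrt (2*a*x)) *
                     sqrt (1 - 2 * C * g (sqrt (2*a*x)) / (a * sqrt (2*a*x))))))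
     \<and> (\<forall>\<epsilon>>0. \<exists>C>0.
          Liminf at_top (\<lambda>x. ereal (measure M {\<omega> \<in> space M. rw_A X \<omega> > x}
                     / Fbar M X (sqrt (2*a*x) + C * x powr (1/4 + \<epsilon>))))
            \<ge> ereal (prob_space.expectation M (\<lambda>\<omega>. real (rw_tau X \<omega>))))
     \<and> ((\<exists>\<gamma>0. 0 < \<gamma>0 \<and> \<gamma>0 < 1
            \<and> (\<forall>x y. 0 < x \<longrightarrow> x \<le> y \<longrightarrow> g y / y powr \<gamma>0 \<le> g x / x powr \<gamma>0)
            \<and> ((\<lambda>x. g x / x powr \<gamma>0) \<longlongrightarrow> 0) at_top)
        \<longrightarrow> ((\<lambda>x. ln (measure M {\<omega> \<in> space M. rw_A X \<omega> > x})
                   / ln (Fbar M X (sqrt (2*a*x)))) \<longlongrightarrow> 1) at_top)"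
proof -
  interpret prob_space M by fact
  interpret subexponential_walk M X a g
    by unfold_locales (fact assms)+
  show ?thesis
  proof (intro conjI impI allI)
    show "\<exists>C>0. \<forall>\<^sub>F x in at_top. prob {\<omega> \<in> space M. rw_A X \<omega> > x}
        \<le> C * x powr (1/4) * exp (- (g (sqrt (2*a*x)) *
            sqrt (1 - 2 * C * g (sqrt (2*a*x)) / (a * sqrt (2*a*x)))))"
      by (rule upper_bound)
    show "\<exists>C>0. ereal (expectation (\<lambda>\<omega>. real (rw_tau X \<omega>))) \<le>
        Liminf at_top (\<lambda>x. ereal (prob {\<omega> \<in> space M. rw_A X \<omega> > x}
          / Fbar M X (sqrt (2*a*x) + C * x powr (1/4 + \<epsilon>))))" if "\<epsilon> > 0" for \<epsilon>
      \<comment> \<open>The constant 1 works for every \<epsilon>.\<close>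
      using lower_bound[OF that] by (intro exI[of _ 1]) simp
  next
    assume "\<exists>\<gamma>0. 0 < \<gamma>0 \<and> \<gamma>0 < 1
      \<and> (\<forall>x y. 0 < x \<longrightarrow> x \<le> y \<longrightarrow> g y / y powr \<gamma>0 \<le> g x / x powr \<gamma>0)
      \<and> ((\<lambda>x. g x / x powr \<gamma>0) \<longlongrightarrow> 0) at_top"
    then show "((\<lambda>x. ln (prob {\<omega> \<in> space M. rw_A X \<omega> > x}) / ln (Fbar M X (sqrt (2*a*x)))) \<longlongrightarrow> 1) at_top"
      using log_asymptotics by blast
  qed
qed

end
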